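(* Let $(\theta_n)_{n\in\mathbb{N}}\subset(0,1)$ with $\lim_n\theta_n=0$ and $\lim_n\theta_n^{1/n}=1$, let $s\in\mathbb{N}$, and let $(\alpha_n)_{n\in\mathbb{N}}\subset(0,1)$ satisfy $\sum_n\alpha_n=1$ and $0<\ell\le\alpha_{n+1}/\alpha_n\le u<1$ for all $n$, for some $\ell,u\in(0,1)$. Let $V'$ and $W'$ be the associated spaces defined in the context. Let $\beta=(\beta_n)_{n\in\mathbb{N}}\subset(0,1)$ with $\sum_n\beta_n=1$ and $0<\inf_n\frac{\beta_{n+1}}{\beta_n}\le\sup_n\frac{\beta_{n+1}}{\beta_n}<1$. Then the $2$-convexifications $V'^{(2)}$ and $W'^{(2)}$ are not isomorphic to $E_\beta$.
   Context: $\mathbb{N}=\{1,2,\dots\}$. $c_{00}$ is the space of finitely supported real sequences. For $x\in c_{00}$ and $E\subseteq\mathbb{N}$, $Ex$ is the restriction of $x$ to $E$ (zero off $E$). For finite sets $F,G\subset\mathbb{N}$, $F<G$ means $\max F<\min G$ or one of them is empty; $n\le F$ means $n\le\min F$ or $F=\emptyset$. Schreier families: $S_0=\{\{n\}:n\in\mathbb{N}\}\cup\{\emptyset\}$ and, for $n\ge0$, $S_{n+1}=\{\bigcup_{i=1}^kF_i: k\in\mathbb{N},\ k\le F_1<F_2<\cdots<F_k,\ F_i\in S_n\}$. A finite family $(E_i)$ of finite non-empty subsets of $\mathbb{N}$ is $S_n$-admissible if $E_1<E_2<\cdots$ and $\{\min E_i\}_i\in S_n$; it is $S_n$-allowable if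 the $E_i$ are pairwise disjoint and $\{\min E_i\}_i\in S_n$. For $x\in c_{00}$ let $\|x\|_{V,0}=\|x\|_{W,0}=\|x\|_\infty$ and, for integers $m\ge0$ (suprema over $n\in\mathbb{N}$), $$\|x\|_{V,m+1}=\|x\|_\infty\vee\sup_n\sup\Big\{\theta_n\sum_i\|E_ix\|_{V,m}:(E_i)\ S_n\text{-allowable}\Big\},$$ $$\|x\|_{W,m+1}=\|x\|_\infty\vee\sup_{n\le s}\sup\Big\{\theta_n\sum_i\|E_ix\|_{W,m}:(E_i)\ S_n\text{-allowable}\Big\}\vee\sup_{n\ge s+1}\sup\Big\{\theta_n\sum_i\|E_ix\|_{W,m}:(E_i)\ S_n\text{-admissible}\Big\}.$$ $V'$ and $W'$ are the completions of $c_{00}$ under $\|x\|_{V'}=\sum_{m=1}^\infty\alpha_m\|x\|_{V,m}$ and $\|x\|_{W'}=\sum_{m=1}^\infty\alpha_m\|x\|_{W,m}$ respectively; the unit vectors form an unconditional basis of each. For a Banach space $(X,\|\cdot\|)$ with such an unconditional basis, the $2$-convexification $X^{(2)}$ consists of the sequences $x$ with $x^2\in X$ (coordinatewise square), with norm $\|x\|_{(2)}=\|x^2\|^{1/2}$. Edgington's space $E_\beta$: for $x\in c_{00}$ let $\|x\|_{E,0}=\|x\|_\infty$ and, for $n\ge0$, $\|x\|_{E,n+1}^2=\sup\{\sum_i\|E_ix\|_{E,n}^2:(E_i)\ S_1\text{-admissible}\}$. $E_\beta$ is the completion of $c_{00}$ under $\|x\|_{E_\beta}=\big(\sum_{n=1}^\infty\beta_n\|x\|_{E,n}^2\big)^{1/2}$.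 "Isomorphic" means linearly homeomorphic. *)

theory Defs
  imports "HOL-Analysis.Analysis"
begin

text \<open>
  The index set of all sequences is \<open>{1, 2, \<dots>}\<close>. It is rendered inside \<open>nat\<close>: subsets of the index
  set are subsets of \<open>{1..}\<close>, and every sequence under consideration vanishes at \<open>0\<close>. Values at \<open>0\<close> of
  the parameter sequences \<open>\<theta>\<close>, \<open>\<alpha>\<close>, \<open>\<beta>\<close> are never used.
\<close>

definition c00 :: "(nat \<Rightarrow> real) set" where
  "c00 = {x. finite {n. x n \<noteq> 0} \<and> x 0 = 0}"

definition restr :: "nat set \<Rightarrow> (nat \<Rightarrow> real) \<Rightarrow> nat \<Rightarrow> real" where
  "restr E x = (\<lambda>n. if n \<in> E then x n else 0)"

definition sup_norm :: "(nat \<Rightarrow> real) \<Rightarrow> real" where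
  "sup_norm x = (SUP n\<in>{1..}. \<bar>x n\<bar>)"

definition set_less :: "nat set \<Rightarrow> nat set \<Rightarrow> bool" where
  "set_less F G \<longleftrightarrow> F = {} \<or> G = {} \<or> Max F < Min G"

definition nat_le_set :: "nat \<Rightarrow> nat set \<Rightarrow> bool" where
  "nat_le_set n F \<longleftrightarrow> F = {} \<or> n \<le> Min F"

text \<open>
  Since some \<open>F i\<close> may be empty, the chain \<open>k \<le> F\<^sub>1 < \<dots> < F\<^sub>k\<close> does not follow from its consecutive
  members; it is read as \<open>k \<le> F\<^sub>i\<close> for all \<open>i\<close> and \<open>F\<^sub>i < F\<^sub>j\<close> for all \<open>i < j\<close>.
\<close>

fun schreier :: "nat \<Rightarrow> nat set set" where
  "schreier 0 = insert {} {{n} | n. n \<ge> 1}"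
| "schreier (Suc n) =
    {(\<Union>i\<in>{1..k}. F i) | k F. k \<ge> 1 \<and>
       (\<forall>i\<in>{1..k}. F i \<in> schreier n \<and> nat_le_set k (F i)) \<and>
       (\<forall>i\<in>{1..k}. \<forall>j\<in>{1..k}. i < j \<longrightarrow> set_less (F i) (F j))}"

text \<open>A finite family \<open>(E\<^sub>1, \<dots>, E\<^sub>k)\<close> is given by its length \<open>k\<close> and a function used on \<open>{1..k}\<close> only.\<close>

definition set_family :: "nat \<Rightarrow> (nat \<Rightarrow> nat set) \<Rightarrow> bool" where
  "set_family k E \<longleftrightarrow> (\<forall>i\<in>{1..k}. finite (E i) \<and> E i \<noteq> {} \<and> E i \<subseteq> {1..})"

definition admissible :: "nat \<Rightarrow> nat \<Rightarrow> (nat \<Rightarrow> nat set) \<Rightarrow> bool" where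
  "admissible n k E \<longleftrightarrow> set_family k E \<and>
     (\<forall>i\<in>{1..k}. \<forall>j\<in>{1..k}. i < j \<longrightarrow> set_less (E i) (E j)) \<and>
     (\<lambda>i. Min (E i)) ` {1..k} \<in> schreier n"

definition allowable :: "nat \<Rightarrow> nat \<Rightarrow> (nat \<Rightarrow> nat set) \<Rightarrow> bool" where
  "allowable n k E \<longleftrightarrow> set_family k E \<and> disjoint_family_on E {1..k} \<and>
     (\<lambda>i. Min (E i)) ` {1..k} \<in> schreier n"

text \<open>
  On \<open>c00\<close> all suprema below are over nonempty sets bounded above: by the \<open>\<ell>\<^sub>1\<close>-norm of \<open>x\<close> for
  \<open>V_norm\<close> and \<open>W_norm\<close> (when \<open>0 < \<theta> n < 1\<close>), by the squared \<open>\<ell>\<^sub>2\<close>-norm of \<open>x\<close> for \<open>E_norm\<close>.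
\<close>

fun V_norm :: "(nat \<Rightarrow> real) \<Rightarrow> nat \<Rightarrow> (nat \<Rightarrow> real) \<Rightarrow> real" where
  "V_norm \<theta> 0 x = sup_norm x"
| "V_norm \<theta> (Suc m) x =
    max (sup_norm x)
      (SUP n\<in>{1..}. SUP (k, E)\<in>{(k, E). allowable n k E}.
         \<theta> n * (\<Sum>i\<in>{1..k}. V_norm \<theta> m (restr (E i) x)))"

fun W_norm :: "(nat \<Rightarrow> real) \<Rightarrow> nat \<Rightarrow> nat \<Rightarrow> (nat \<Rightarrow> real) \<Rightarrow> real" where
  "W_norm \<theta> s 0 x = sup_norm x"
| "W_norm \<theta> s (Suc m) x =
    max (sup_norm x) (max
      (SUP n\<in>{1..s}. SUP (k, E)\<in>{(k, E). allowable n k E}.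
         \<theta> n * (\<Sum>i\<in>{1..k}. W_norm \<theta> s m (restr (E i) x)))
      (SUP n\<in>{s+1..}. SUP (k, E)\<in>{(k, E). admissible n k E}.
         \<theta> n * (\<Sum>i\<in>{1..k}. W_norm \<theta> s m (restr (E i) x))))"

fun E_norm :: "nat \<Rightarrow> (nat \<Rightarrow> real) \<Rightarrow> real" where
  "E_norm 0 x = sup_norm x"
| "E_norm (Suc m) x =
    sqrt (SUP (k, E)\<in>{(k, E). admissible 1 k E}. \<Sum>i\<in>{1..k}. (E_norm m (restr (E i) x))\<^sup>2)"

definition V'_norm :: "(nat \<Rightarrow> real) \<Rightarrow> (nat \<Rightarrow> real) \<Rightarrow> (nat \<Rightarrow> real) \<Rightarrow> real" where
  "V'_norm \<theta> \<alpha> x = (\<Sum>m. \<alpha> (Suc m) * V_norm \<theta> (Suc m) x)"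

definition W'_norm :: "(nat \<Rightarrow> real) \<Rightarrow> nat \<Rightarrow> (nat \<Rightarrow> real) \<Rightarrow> (nat \<Rightarrow> real) \<Rightarrow> real" where
  "W'_norm \<theta> s \<alpha> x = (\<Sum>m. \<alpha> (Suc m) * W_norm \<theta> s (Suc m) x)"

definition E\<beta>_norm :: "(nat \<Rightarrow> real) \<Rightarrow> (nat \<Rightarrow> real) \<Rightarrow> real" where
  "E\<beta>_norm \<beta> x = sqrt (\<Sum>m. \<beta> (Suc m) * (E_norm (Suc m) x)\<^sup>2)"

text \<open>
  A normed space of sequences is a pair of its carrier and its norm (relevant on the carrier only).
\<close>

type_synonym seq_space = "(nat \<Rightarrow> real) set \<times> ((nat \<Rightarrow> real) \<Rightarrow> real)"

text \<open>
  The completion of \<open>c00\<close> under a norm \<open>N\<close>, realized as a space of sequences: the point given by an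
  \<open>N\<close>-Cauchy sequence \<open>u\<close> in \<open>c00\<close> is identified with the coordinatewise limit of \<open>u\<close>, and its norm is
  the limit of \<open>N (u k)\<close>. This identification is injective (so that the norm is well defined) whenever
  \<open>N\<close> dominates the supremum norm and restricting to an initial segment does not increase \<open>N\<close>: if \<open>w\<close>
  is \<open>N\<close>-Cauchy with coordinatewise limit \<open>0\<close>, then \<open>N (w k)\<close> tends to \<open>0\<close>. All norms below are of
  this kind.
\<close>

definition c00_Cauchy :: "((nat \<Rightarrow> real) \<Rightarrow> real) \<Rightarrow> (nat \<Rightarrow> nat \<Rightarrow> real) \<Rightarrow> bool" where
  "c00_Cauchy N u \<longleftrightarrow> (\<forall>k. u k \<in> c00) \<and>
     (\<forall>\<epsilon>>0. \<exists>K. \<forall>i\<ge>K. \<forall>j\<ge>K. N (\<lambda>n. u i n - u j n) < \<epsilon>)"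

definition completion :: "((nat \<Rightarrow> real) \<Rightarrow> real) \<Rightarrow> seq_space" where
  "completion N =
    ({x. \<exists>u. c00_Cauchy N u \<and> (\<forall>n. (\<lambda>k. u k n) \<longlonglongrightarrow> x n)},
     \<lambda>x. THE r. \<exists>u. c00_Cauchy N u \<and> (\<forall>n. (\<lambda>k. u k n) \<longlonglongrightarrow> x n) \<and> (\<lambda>k. N (u k)) \<longlonglongrightarrow> r)"

definition V'_space :: "(nat \<Rightarrow> real) \<Rightarrow> (nat \<Rightarrow> real) \<Rightarrow> seq_space" where
  "V'_space \<theta> \<alpha> = completion (V'_norm \<theta> \<alpha>)"

definition W'_space :: "(nat \<Rightarrow> real) \<Rightarrow> nat \<Rightarrow> (nat \<Rightarrow> real) \<Rightarrow> seq_space" where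
  "W'_space \<theta> s \<alpha> = completion (W'_norm \<theta> s \<alpha>)"

definition E_space :: "(nat \<Rightarrow> real) \<Rightarrow> seq_space" where
  "E_space \<beta> = completion (E\<beta>_norm \<beta>)"

definition convexification2 :: "seq_space \<Rightarrow> seq_space" where
  "convexification2 X =
    ({x. (\<lambda>n. (x n)\<^sup>2) \<in> fst X}, \<lambda>x. sqrt (snd X (\<lambda>n. (x n)\<^sup>2)))"

definition linear_on_space :: "seq_space \<Rightarrow> ((nat \<Rightarrow> real) \<Rightarrow> (nat \<Rightarrow> real)) \<Rightarrow> bool" where
  "linear_on_space X T \<longleftrightarrow>
    (\<forall>x\<in>fst X. \<forall>y\<in>fst X. \<forall>a b. T (\<lambda>n. a * x n + b * y n) = (\<lambda>n. a * T x n + b * T y n))"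

definition continuous_between ::
    "seq_space \<Rightarrow> seq_space \<Rightarrow> ((nat \<Rightarrow> real) \<Rightarrow> (nat \<Rightarrow> real)) \<Rightarrow> bool" where
  "continuous_between X Y T \<longleftrightarrow>
    (\<forall>x\<in>fst X. \<forall>\<epsilon>>0. \<exists>\<delta>>0. \<forall>y\<in>fst X.
       snd X (\<lambda>n. y n - x n) < \<delta> \<longrightarrow> snd Y (\<lambda>n. T y n - T x n) < \<epsilon>)"

definition isomorphic :: "seq_space \<Rightarrow> seq_space \<Rightarrow> bool" where
  "isomorphic X Y \<longleftrightarrow>
    (\<exists>T. linear_on_space X T \<and> bij_betw T (fst X) (fst Y) \<and>
         continuous_between X Y T \<and> continuous_between Y X (inv_into (fst X) T))"

end

theory Submission
  imports Defs
begin

text \<open>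
  Suppose that \<open>S\<close> is an isomorphism of \<open>E_space \<beta>\<close> onto the \<open>2\<close>-convexification of \<open>V'\<close> or \<open>W'\<close>. The unit
  vectors of \<open>E_space \<beta>\<close> have an upper \<open>\<ell>\<^sub>2\<close>-estimate, so their images tend to \<open>0\<close> coordinatewise, and a
  subsequence of the images is close to a sequence of disjoint blocks. As \<open>\<alpha> (n + 1) \<ge> l * \<alpha> n\<close>,
  \<open>S\<^sub>n\<close>-admissible blocks have a lower \<open>\<ell>\<^sub>2\<close>-estimate whose squared constant is \<open>l * \<theta> n\<close>. On the other side,
  repeated averaging, \<open>n\<close> times, yields coefficients \<open>a \<ge> 0\<close> with sum \<open>1\<close>, supported where the minima of
  the blocks form a set in \<open>S\<^sub>n\<close>, such that the combination of unit vectors with coefficients \<open>sqrt a\<close> is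
  small for \<open>E_norm m\<close> for all \<open>m < n\<close>; its squared norm in \<open>E_space \<beta>\<close> is then at most of the order
  of the tail \<open>\<Sum>m\<ge>n. \<beta> m\<close>, which decays geometrically. Hence \<open>\<theta> n \<le> K * v ^ n\<close> with \<open>v < 1\<close>,
  contradicting \<open>(\<theta> n) powr (1 / n) \<longlonglongrightarrow> 1\<close>.
\<close>

text \<open>Nothing relates the position \<open>i k\<close> of a unit vector to the place where its
  image lives, so one set of coefficients has to meet two demands: smallness of \<open>phi\<close>
  at the positions \<open>i k\<close>, and a Schreier support with respect to the minima of the
  blocks. Hence the averages are built for two independent increasing sequences at once. The two
  spaces are handled together through a property they share: as admissible families are allowable,
  both have the lower estimate for S_n-admissible families, for every n. All estimates are made for
  squares, which removes the convexifications: the square of \<open>E_norm\<close> is a lattice norm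
  of the squared vector, coefficients \<open>sqrt a\<close> become \<open>a\<close>, and the lower
  l_2-estimate becomes an l_1-estimate. The price is linearity: the square of an image is compared
  with the sum of its squared blocks by Cauchy-Schwarz, which costs a factor 2. The contradiction
  rests on uniformity: \<open>l\<close> and the constants of the isomorphism do not depend on
  n.\<close>

section \<open>Finitely supported sequences, their l_1-norm and supremum norm\<close>

definition l1 :: "(nat \<Rightarrow> real) \<Rightarrow> real" where
  "l1 x = (\<Sum>n\<in>{n. x n \<noteq> 0}. \<bar>x n\<bar>)"

definition unit_vec :: "nat \<Rightarrow> nat \<Rightarrow> real" where
  "unit_vec i = (\<lambda>n. if n = i then 1 else 0)"

definition trunc :: "nat \<Rightarrow> (nat \<Rightarrow> real) \<Rightarrow> nat \<Rightarrow> real" where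
  "trunc m = restr {..m}"

lemma trunc_apply: "trunc m x n = (if n \<le> m then x n else 0)"
  by (simp add: trunc_def restr_def)

lemma c00_zero: "(\<lambda>n. 0) \<in> c00"
  by (simp add: c00_def)

lemma c00_add: "x \<in> c00 \<Longrightarrow> y \<in> c00 \<Longrightarrow> (\<lambda>n. x n + y n) \<in> c00"
  unfolding c00_def
  by (auto intro: finite_subset[of _ "{n. x n \<noteq> 0} \<union> {n. y n \<noteq> 0}"])

lemma c00_dominated:
  assumes "y \<in> c00" "\<And>n. y n = 0 \<Longrightarrow> x n = 0"
  shows "x \<in> c00"
proof -
  have "{n. x n \<noteq> 0} \<subseteq> {n. y n \<noteq> 0}" using assms(2) by auto
  then show ?thesis using assms unfolding c00_def by (auto intro: finite_subset)
qed

lemma c00_scale: "x \<in> c00 \<Longrightarrow> (\<lambda>n. a * x n) \<in> c00"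
  by (rule c00_dominated) auto

lemma c00_diff: "x \<in> c00 \<Longrightarrow> y \<in> c00 \<Longrightarrow> (\<lambda>n. x n - y n) \<in> c00"
  using c00_add[of x "\<lambda>n. -1 * y n"] c00_scale[of y "-1"] by simp

lemma c00_restr:
  assumes "x \<in> c00"
  shows "restr E x \<in> c00"
  by (rule c00_dominated[OF assms]) (simp add: restr_def)

lemma c00_power2: "x \<in> c00 \<Longrightarrow> (\<lambda>n. (x n)\<^sup>2) \<in> c00"
  by (rule c00_dominated) auto

lemma c00_unit_vec: "i \<ge> 1 \<Longrightarrow> unit_vec i \<in> c00"
  by (auto simp: c00_def unit_vec_def)

lemma c00_sum:
  assumes "finite F" "\<And>k. k \<in> F \<Longrightarrow> x k \<in> c00"
  shows "(\<lambda>n. \<Sum>k\<in>F. x k n) \<in> c00"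
  using assms by (induction F rule: finite_induct) (auto intro: c00_add c00_zero)

lemma trunc_c00: "x 0 = 0 \<Longrightarrow> trunc m x \<in> c00"
  unfolding c00_def trunc_apply by (auto intro: finite_subset[of _ "{..m}"])

lemma c00_vanish:
  assumes "x \<in> c00"
  obtains m where "\<And>n. n > m \<Longrightarrow> x n = 0"
proof -
  have "bdd_above {n. x n \<noteq> 0}" using assms by (auto simp: c00_def)
  then obtain m where "\<And>n. x n \<noteq> 0 \<Longrightarrow> n \<le> m" by (auto simp: bdd_above_def)
  then show ?thesis using that by (meson not_less)
qed

lemma l1_eq_sum:
  assumes "finite F" "\<And>n. n \<notin> F \<Longrightarrow> x n = 0"
  shows "l1 x = (\<Sum>n\<in>F. \<bar>x n\<bar>)"
  unfolding l1_def by (rule sum.mono_neutral_left) (use assms in auto)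

lemma abs_le_l1: "x \<in> c00 \<Longrightarrow> \<bar>x n\<bar> \<le> l1 x"
  unfolding l1_def c00_def
  by (cases "x n = 0") (auto intro!: sum_nonneg member_le_sum[where f="\<lambda>n. \<bar>x n\<bar>"])

text \<open>With factors \<open>\<theta> n\<close> at most 1, this bounds every supremum over
  families that occurs in the recursive definitions.\<close>

lemma l1_disjoint:
  assumes "x \<in> c00" "disjoint_family_on E I" "finite I"
  shows "(\<Sum>i\<in>I. l1 (restr (E i) x)) \<le> l1 x"
proof -
  let ?S = "{n. x n \<noteq> 0}"
  have fin: "finite ?S" using assms by (simp add: c00_def)
  have "(\<Sum>i\<in>I. l1 (restr (E i) x)) = (\<Sum>i\<in>I. \<Sum>n\<in>?S \<inter> E i. \<bar>x n\<bar>)"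
  proof (rule sum.cong[OF refl])
    fix i
    have "l1 (restr (E i) x) = (\<Sum>n\<in>?S \<inter> E i. \<bar>restr (E i) x n\<bar>)"
      by (rule l1_eq_sum) (use fin in \<open>auto simp: restr_def\<close>)
    then show "l1 (restr (E i) x) = (\<Sum>n\<in>?S \<inter> E i. \<bar>x n\<bar>)"
      by (auto simp: restr_def)
  qed
  also have "\<dots> = (\<Sum>n\<in>(\<Union>i\<in>I. ?S \<inter> E i). \<bar>x n\<bar>)"
    by (rule sum.UNION_disjoint[symmetric])
      (use fin assms in \<open>auto simp: disjoint_family_on_def\<close>)
  also have "\<dots> \<le> l1 x"
    unfolding l1_def by (rule sum_mono2) (use fin in auto)
  finally show ?thesis .
qed

lemma sup_norm_upper:
  assumes "x \<in> c00" "n \<ge> 1"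
  shows "\<bar>x n\<bar> \<le> sup_norm x"
  unfolding sup_norm_def
  by (rule cSUP_upper) (use assms abs_le_l1 in \<open>auto intro!: bdd_aboveI\<close>)

lemma sup_norm_least: "(\<And>n. n \<ge> 1 \<Longrightarrow> \<bar>x n\<bar> \<le> B) \<Longrightarrow> sup_norm x \<le> B"
  unfolding sup_norm_def by (rule cSUP_least) auto

lemma sup_norm_nonneg: "x \<in> c00 \<Longrightarrow> 0 \<le> sup_norm x"
  using sup_norm_upper[of x 1] by simp

lemma sup_norm_le_l1: "x \<in> c00 \<Longrightarrow> sup_norm x \<le> l1 x"
  by (rule sup_norm_least) (rule abs_le_l1)

lemma restr_add: "restr E (\<lambda>n. x n + y n) = (\<lambda>n. restr E x n + restr E y n)"
  by (auto simp: restr_def)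

lemma restr_scale: "restr E (\<lambda>n. a * x n) = (\<lambda>n. a * restr E x n)"
  by (auto simp: restr_def)

lemma sup_norm_add:
  assumes "x \<in> c00" "y \<in> c00"
  shows "sup_norm (\<lambda>n. x n + y n) \<le> sup_norm x + sup_norm y"
  by (rule sup_norm_least) (use sup_norm_upper[OF assms(1)] sup_norm_upper[OF assms(2)] in
    \<open>meson abs_triangle_ineq add_mono order_trans\<close>)

lemma sup_norm_scale:
  assumes "x \<in> c00"
  shows "sup_norm (\<lambda>n. a * x n) \<le> \<bar>a\<bar> * sup_norm x"
  by (rule sup_norm_least) (use sup_norm_upper[OF assms] in \<open>simp add: abs_mult mult_left_mono\<close>)

section \<open>Lattice norms on finitely supported sequences and their completions\<close>

text \<open>Nonnegativity and definiteness come from \<open>coord\<close>; \<open>mono\<close> makes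
  truncation a contraction, which is what realizes the completion inside the sequences. Homogeneity
  is required as an inequality, the form that passes directly through suprema and sums; scaling back
  by \<open>1 / a\<close> gives equality.\<close>

locale lattice_norm =
  fixes N :: "(nat \<Rightarrow> real) \<Rightarrow> real"
  assumes coord: "x \<in> c00 \<Longrightarrow> n \<ge> 1 \<Longrightarrow> \<bar>x n\<bar> \<le> N x"
    and mono: "x \<in> c00 \<Longrightarrow> y \<in> c00 \<Longrightarrow> (\<And>n. \<bar>x n\<bar> \<le> \<bar>y n\<bar>) \<Longrightarrow> N x \<le> N y"
    and add: "x \<in> c00 \<Longrightarrow> y \<in> c00 \<Longrightarrow> N (\<lambda>n. x n + y n) \<le> N x + N y"
    and scale_le: "x \<in> c00 \<Longrightarrow> N (\<lambda>n. a * x n) \<le> \<bar>a\<bar> * N x"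
begin

abbreviation "CN \<equiv> fst (completion N)"
abbreviation "NN \<equiv> snd (completion N)"

lemma nonneg: "x \<in> c00 \<Longrightarrow> 0 \<le> N x"
  using coord[of x 1] by auto

lemma zero: "N (\<lambda>n. 0) = 0"
  using scale_le[of "\<lambda>n. 0" 0] nonneg[of "\<lambda>n. 0"] by (simp add: c00_zero)

lemma sum_le:
  assumes "finite F" "\<And>k. k \<in> F \<Longrightarrow> x k \<in> c00"
  shows "N (\<lambda>n. \<Sum>k\<in>F. x k n) \<le> (\<Sum>k\<in>F. N (x k))"
  using assms
proof (induction F rule: finite_induct)
  case empty
  then show ?case by (simp add: zero)
next
  case (insert k F)
  have "N (\<lambda>n. x k n + (\<Sum>k\<in>F. x k n)) \<le> N (x k) + N (\<lambda>n. \<Sum>k\<in>F. x k n)"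
    by (rule add) (use insert in \<open>auto intro: c00_sum\<close>)
  then show ?case using insert by auto
qed

text \<open>On vectors living on \<open>{1..m}\<close> the norm is controlled by the coordinates, so
  there coordinatewise convergence is norm convergence.\<close>

lemma finite_dim_bound:
  assumes "x \<in> c00" "\<And>n. n > m \<Longrightarrow> x n = 0"
  shows "N x \<le> (\<Sum>n\<in>{1..m}. \<bar>x n\<bar> * N (unit_vec n))"
proof -
  have "x j = (\<Sum>n\<in>{1..m}. x n * unit_vec n j)" for j
  proof -
    have "(\<Sum>n\<in>{1..m}. x n * unit_vec n j) = (\<Sum>n\<in>{1..m}. if n = j then x j else 0)"
      by (rule sum.cong) (auto simp: unit_vec_def)
    also have "\<dots> = x j"
      using assms by (cases "j = 0") (auto simp: c00_def)
    finally show ?thesis by simp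
  qed
  then have "N x = N (\<lambda>j. \<Sum>n\<in>{1..m}. x n * unit_vec n j)"
    by (intro arg_cong[where f = N] ext)
  also have "\<dots> \<le> (\<Sum>n\<in>{1..m}. N (\<lambda>j. x n * unit_vec n j))"
    by (rule sum_le) (auto intro!: c00_scale c00_unit_vec)
  also have "\<dots> \<le> (\<Sum>n\<in>{1..m}. \<bar>x n\<bar> * N (unit_vec n))"
    by (intro sum_mono scale_le c00_unit_vec) auto
  finally show ?thesis .
qed

lemma trunc_tendsto_zero:
  assumes "\<And>n. (\<lambda>k. y k n) \<longlonglongrightarrow> 0" "\<And>k. y k 0 = 0"
  shows "(\<lambda>k. N (trunc m (y k))) \<longlonglongrightarrow> 0"
proof (rule tendsto_sandwich[where f = "\<lambda>_. 0"])
  show "(\<lambda>k. \<Sum>n\<in>{1..m}. \<bar>y k n\<bar> * N (unit_vec n)) \<longlonglongrightarrow> 0"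
    using assms(1) by (intro tendsto_null_sum tendsto_mult_left_zero tendsto_rabs_zero)
  show "\<forall>\<^sub>F k in sequentially. 0 \<le> N (trunc m (y k))"
    using assms by (intro always_eventually allI nonneg trunc_c00)
  have "N (trunc m (y k)) \<le> (\<Sum>n\<in>{1..m}. \<bar>y k n\<bar> * N (unit_vec n))" for k
    using finite_dim_bound[of "trunc m (y k)" m] assms(2) trunc_c00[of "y k" m]
    by (simp add: trunc_apply)
  then show "\<forall>\<^sub>F k in sequentially. N (trunc m (y k)) \<le> (\<Sum>n\<in>{1..m}. \<bar>y k n\<bar> * N (unit_vec n))"
    by simp
qed auto

lemma limit_at_0:
  assumes "c00_Cauchy N u" "\<And>n. (\<lambda>k. u k n) \<longlonglongrightarrow> x n"
  shows "x 0 = 0"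
proof -
  have "u k 0 = 0" for k using assms(1) by (simp add: c00_Cauchy_def c00_def)
  then have "(\<lambda>k. 0) \<longlonglongrightarrow> x 0" using assms(2)[of 0] by simp
  then show ?thesis using LIMSEQ_unique tendsto_const by blast
qed

text \<open>The limit \<open>x\<close> need not be in \<open>c00\<close>, so the Cauchy estimate is
  passed to it on initial segments, where the norm follows the coordinates. The index
  \<open>K\<close> serves all segments simultaneously.\<close>

lemma Cauchy_approx:
  assumes u: "c00_Cauchy N u" and x: "\<And>n. (\<lambda>k. u k n) \<longlonglongrightarrow> x n" and "\<epsilon> > 0"
  shows "\<exists>K. \<forall>k\<ge>K. \<forall>m. N (trunc m (\<lambda>n. u k n - x n)) \<le> \<epsilon>"
proof -
  obtain K where K: "\<And>i j. i \<ge> K \<Longrightarrow> j \<ge> K \<Longrightarrow> N (\<lambda>n. u i n - u j n) < \<epsilon>"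
    using u \<open>\<epsilon> > 0\<close> unfolding c00_Cauchy_def by meson
  have uc: "u k \<in> c00" for k using u by (simp add: c00_Cauchy_def)
  then have u0: "u k 0 = 0" for k by (simp add: c00_def)
  have x0: "x 0 = 0" using limit_at_0[OF u x] .
  have "N (trunc m (\<lambda>n. u k n - x n)) \<le> \<epsilon>" if "k \<ge> K" for k m
  proof (rule LIMSEQ_le_const)
    show "(\<lambda>j. \<epsilon> + N (trunc m (\<lambda>n. u j n - x n))) \<longlonglongrightarrow> \<epsilon>"
    proof -
      have "(\<lambda>j. u j n - x n) \<longlonglongrightarrow> 0" for n using x[of n] LIM_zero by blast
      then have "(\<lambda>j. N (trunc m (\<lambda>n. u j n - x n))) \<longlonglongrightarrow> 0"
        by (intro trunc_tendsto_zero) (auto simp: u0 x0)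
      then show ?thesis using tendsto_add[OF tendsto_const] by fastforce
    qed
    have "N (trunc m (\<lambda>n. u k n - x n)) \<le> \<epsilon> + N (trunc m (\<lambda>n. u j n - x n))" if "j \<ge> K" for j
    proof -
      have "trunc m (\<lambda>n. u k n - x n) =
          (\<lambda>n. trunc m (\<lambda>n. u k n - u j n) n + trunc m (\<lambda>n. u j n - x n) n)"
        by (auto simp: trunc_apply)
      then have "N (trunc m (\<lambda>n. u k n - x n)) \<le>
          N (trunc m (\<lambda>n. u k n - u j n)) + N (trunc m (\<lambda>n. u j n - x n))"
        using add[of "trunc m (\<lambda>n. u k n - u j n)" "trunc m (\<lambda>n. u j n - x n)"]
        by (simp add: trunc_c00 u0 x0)
      moreover have "N (trunc m (\<lambda>n. u k n - u j n)) \<le> N (\<lambda>n. u k n - u j n)"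
        by (rule mono) (auto simp: trunc_c00 u0 trunc_apply uc c00_diff)
      moreover have "N (\<lambda>n. u k n - u j n) < \<epsilon>" using K \<open>k \<ge> K\<close> that by blast
      ultimately show ?thesis by linarith
    qed
    then show "\<exists>J. \<forall>j\<ge>J. N (trunc m (\<lambda>n. u k n - x n)) \<le> \<epsilon> + N (trunc m (\<lambda>n. u j n - x n))"
      by blast
  qed
  then show ?thesis by blast
qed

text \<open>Once \<open>m\<close> passes the support of \<open>u k\<close>, the difference
  \<open>u k - trunc m x\<close> is itself the truncation of \<open>u k - x\<close>.\<close>

lemma trunc_approx:
  assumes u: "c00_Cauchy N u" and x: "\<And>n. (\<lambda>k. u k n) \<longlonglongrightarrow> x n" and "\<epsilon> > 0"
  shows "\<exists>K. \<forall>k\<ge>K. \<exists>M. \<forall>m\<ge>M. N (\<lambda>n. u k n - trunc m x n) \<le> \<epsilon>"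
proof -
  obtain K where K: "\<And>k m. k \<ge> K \<Longrightarrow> N (trunc m (\<lambda>n. u k n - x n)) \<le> \<epsilon>"
    using Cauchy_approx[OF assms] by blast
  have "\<exists>M. \<forall>m\<ge>M. N (\<lambda>n. u k n - trunc m x n) \<le> \<epsilon>" if k: "k \<ge> K" for k
  proof -
    have "u k \<in> c00" using u by (simp add: c00_Cauchy_def)
    then obtain M where M: "\<And>n. n > M \<Longrightarrow> u k n = 0" using c00_vanish by blast
    have "N (\<lambda>n. u k n - trunc m x n) \<le> \<epsilon>" if "m \<ge> M" for m
    proof -
      have "(\<lambda>n. u k n - trunc m x n) = trunc m (\<lambda>n. u k n - x n)"
        using M that by (fastforce simp: trunc_apply)
      then show ?thesis using K k by simp
    qed
    then show ?thesis by blast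
  qed
  then show ?thesis by blast
qed

lemma diff_le: "x \<in> c00 \<Longrightarrow> y \<in> c00 \<Longrightarrow> N x - N y \<le> N (\<lambda>n. x n - y n)"
  using add[of y "\<lambda>n. x n - y n"] by (simp add: c00_diff)

lemma diff_commute: "x \<in> c00 \<Longrightarrow> y \<in> c00 \<Longrightarrow> N (\<lambda>n. x n - y n) = N (\<lambda>n. y n - x n)"
  by (intro antisym mono c00_diff) auto

lemma abs_diff_le:
  assumes "x \<in> c00" "y \<in> c00"
  shows "\<bar>N x - N y\<bar> \<le> N (\<lambda>n. x n - y n)"
  using diff_le[OF assms] diff_le[OF assms(2,1)] diff_commute[OF assms] by linarith

text \<open>The truncations of a point form a canonical sequence representing it, so later arguments
  need not choose one.\<close>

lemma trunc_Cauchy: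
  assumes u: "c00_Cauchy N u" and x: "\<And>n. (\<lambda>k. u k n) \<longlonglongrightarrow> x n"
  shows "c00_Cauchy N (\<lambda>k. trunc k x)"
proof -
  have x0: "x 0 = 0" using limit_at_0[OF u x] .
  have uc: "u k \<in> c00" for k using u by (simp add: c00_Cauchy_def)
  have "\<exists>M. \<forall>i\<ge>M. \<forall>j\<ge>M. N (\<lambda>n. trunc i x n - trunc j x n) < \<epsilon>" if e: "\<epsilon> > 0" for \<epsilon>
  proof -
    obtain k M where M: "\<And>m. m \<ge> M \<Longrightarrow> N (\<lambda>n. u k n - trunc m x n) \<le> \<epsilon> / 3"
      using trunc_approx[OF u x, of "\<epsilon> / 3"] e by (metis divide_pos_pos order_refl zero_less_numeral)
    have "N (\<lambda>n. trunc i x n - trunc j x n) < \<epsilon>" if "i \<ge> M" "j \<ge> M" for i j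
    proof -
      have "N (\<lambda>n. (trunc i x n - u k n) + (u k n - trunc j x n)) \<le>
          N (\<lambda>n. trunc i x n - u k n) + N (\<lambda>n. u k n - trunc j x n)"
        by (intro add c00_diff trunc_c00 uc x0)
      also have "N (\<lambda>n. trunc i x n - u k n) = N (\<lambda>n. u k n - trunc i x n)"
        by (intro diff_commute trunc_c00 uc x0)
      finally show ?thesis using M[OF that(1)] M[OF that(2)] e by simp
    qed
    then show ?thesis by blast
  qed
  then show ?thesis unfolding c00_Cauchy_def using trunc_c00 x0 by blast
qed

lemma trunc_tendsto: "(\<lambda>k. trunc k x n) \<longlonglongrightarrow> x n"
proof (rule tendsto_eventually)
  show "\<forall>\<^sub>F k in sequentially. trunc k x n = x n"
    unfolding eventually_sequentially by (auto simp: trunc_apply)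
qed

lemma CN_iff: "x \<in> CN \<longleftrightarrow> c00_Cauchy N (\<lambda>k. trunc k x)"
  unfolding completion_def using trunc_Cauchy trunc_tendsto by fastforce

lemma Cauchy_convergent:
  assumes u: "c00_Cauchy N u"
  shows "convergent (\<lambda>k. N (u k))"
proof -
  have "Cauchy (\<lambda>k. N (u k))"
    unfolding Cauchy_def
  proof (intro allI impI)
    fix \<epsilon> :: real assume "\<epsilon> > 0"
    then obtain K where K: "\<And>i j. i \<ge> K \<Longrightarrow> j \<ge> K \<Longrightarrow> N (\<lambda>n. u i n - u j n) < \<epsilon>"
      using u unfolding c00_Cauchy_def by meson
    have "dist (N (u i)) (N (u j)) < \<epsilon>" if "i \<ge> K" "j \<ge> K" for i j
      using abs_diff_le[of "u i" "u j"] K[OF that] u by (simp add: dist_real_def c00_Cauchy_def)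
    then show "\<exists>K. \<forall>m\<ge>K. \<forall>n\<ge>K. dist (N (u m)) (N (u n)) < \<epsilon>" by blast
  qed
  then show ?thesis by (simp add: Cauchy_convergent_iff)
qed

text \<open>Justifies the definite description in \<open>completion\<close>: the norms along any
  representing sequence have the same limit as the norms of the truncations of \<open>x\<close>,
  since \<open>trunc_approx\<close> brings the two sequences together.\<close>

lemma NN_eqI:
  assumes u: "c00_Cauchy N u" and x: "\<And>n. (\<lambda>k. u k n) \<longlonglongrightarrow> x n" and r: "(\<lambda>k. N (u k)) \<longlonglongrightarrow> r"
  shows "NN x = r"
proof -
  define L where "L = lim (\<lambda>k. N (trunc k x))"
  have L: "(\<lambda>k. N (trunc k x)) \<longlonglongrightarrow> L"
    using Cauchy_convergent[OF trunc_Cauchy[OF u x]] unfolding L_def convergent_LIMSEQ_iff .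
  have uniq: "q = L"
    if v: "c00_Cauchy N v" and vx: "\<And>n. (\<lambda>k. v k n) \<longlonglongrightarrow> x n" and q: "(\<lambda>k. N (v k)) \<longlonglongrightarrow> q" for v q
  proof -
    have x0: "x 0 = 0" using limit_at_0[OF v vx] .
    have vc: "v k \<in> c00" for k using v by (simp add: c00_Cauchy_def)
    have "(\<lambda>k. N (v k)) \<longlonglongrightarrow> L"
    proof (rule LIMSEQ_I)
      fix \<epsilon> :: real assume e: "\<epsilon> > 0"
      obtain K where K: "\<And>k. k \<ge> K \<Longrightarrow> \<exists>M. \<forall>m\<ge>M. N (\<lambda>n. v k n - trunc m x n) \<le> \<epsilon> / 2"
        using trunc_approx[OF v vx, of "\<epsilon> / 2"] e half_gt_zero by blast
      have "norm (N (v k) - L) < \<epsilon>" if k: "k \<ge> K" for k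
      proof -
        obtain M where M: "\<And>m. m \<ge> M \<Longrightarrow> N (\<lambda>n. v k n - trunc m x n) \<le> \<epsilon> / 2"
          using K[OF k] by blast
        \<comment> \<open>The bound survives letting \<open>m\<close> tend to infinity with
          \<open>k\<close> fixed, although \<open>M\<close> depends on \<open>k\<close>.\<close>
        have "\<bar>N (v k) - N (trunc m x)\<bar> \<le> \<epsilon> / 2" if "m \<ge> M" for m
          using abs_diff_le[of "v k" "trunc m x"] M[OF that] vc trunc_c00[of x m] x0 by force
        moreover have "(\<lambda>m. \<bar>N (v k) - N (trunc m x)\<bar>) \<longlonglongrightarrow> \<bar>N (v k) - L\<bar>"
          by (intro tendsto_intros L)
        ultimately have "\<bar>N (v k) - L\<bar> \<le> \<epsilon> / 2"
          by (intro LIMSEQ_le_const2) blast+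
        then show ?thesis using e by simp
      qed
      then show "\<exists>K. \<forall>k\<ge>K. norm (N (v k) - L) < \<epsilon>" by blast
    qed
    then show ?thesis using q LIMSEQ_unique by blast
  qed
  have "NN x = L"
    unfolding completion_def snd_conv
    by (rule the_equality) (use uniq trunc_Cauchy[OF u x] trunc_tendsto[where x = x] L in blast)+
  then show ?thesis using uniq[OF u x r] by simp
qed

lemma NN_lim:
  assumes "x \<in> CN"
  shows "(\<lambda>k. N (trunc k x)) \<longlonglongrightarrow> NN x"
proof -
  have c: "c00_Cauchy N (\<lambda>k. trunc k x)" using assms by (simp add: CN_iff)
  obtain r where r: "(\<lambda>k. N (trunc k x)) \<longlonglongrightarrow> r"
    using Cauchy_convergent[OF c] by (auto simp: convergent_def)
  show ?thesis using r NN_eqI[OF c trunc_tendsto r] by simp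
qed

section \<open>Order and linear structure of the completion\<close>

lemma Cauchy_const: "x \<in> c00 \<Longrightarrow> c00_Cauchy N (\<lambda>k. x)"
  by (simp add: c00_Cauchy_def zero)

lemma c00_CN: "x \<in> c00 \<Longrightarrow> x \<in> CN"
  unfolding completion_def using Cauchy_const by fastforce

lemma NN_c00: "x \<in> c00 \<Longrightarrow> NN x = N x"
  by (rule NN_eqI[OF Cauchy_const]) auto

lemma CN_0: "x \<in> CN \<Longrightarrow> x 0 = 0"
  unfolding completion_def using limit_at_0 by fastforce

text \<open>The completion is an order ideal, because differences of truncations of \<open>x\<close>
  are dominated by those of \<open>y\<close>. Restrictions to arbitrary sets thereby stay in the
  space.\<close>

lemma CN_dominated:
  assumes "y \<in> CN" "\<And>n. \<bar>x n\<bar> \<le> \<bar>y n\<bar>"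
  shows "x \<in> CN"
proof -
  have y0: "y 0 = 0" and x0: "x 0 = 0" using CN_0[OF assms(1)] assms(2)[of 0] by auto
  have le: "N (\<lambda>n. trunc i x n - trunc j x n) \<le> N (\<lambda>n. trunc i y n - trunc j y n)" for i j
    by (rule mono) (use assms(2) in \<open>auto intro!: c00_diff trunc_c00 x0 y0, auto simp: trunc_apply\<close>)
  have "\<exists>K. \<forall>i\<ge>K. \<forall>j\<ge>K. N (\<lambda>n. trunc i x n - trunc j x n) < \<epsilon>" if e: "\<epsilon> > 0" for \<epsilon>
  proof -
    obtain K where "\<And>i j. i \<ge> K \<Longrightarrow> j \<ge> K \<Longrightarrow> N (\<lambda>n. trunc i y n - trunc j y n) < \<epsilon>"
      using assms(1) e unfolding CN_iff c00_Cauchy_def by meson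
    then show ?thesis using le by (meson order_le_less_trans)
  qed
  then show ?thesis unfolding CN_iff c00_Cauchy_def using trunc_c00 x0 by simp
qed

lemma CN_scale:
  assumes "x \<in> CN"
  shows "(\<lambda>n. a * x n) \<in> CN"
proof -
  have x0: "x 0 = 0" using CN_0[OF assms] .
  have le: "N (\<lambda>n. trunc i (\<lambda>n. a * x n) n - trunc j (\<lambda>n. a * x n) n)
      \<le> \<bar>a\<bar> * N (\<lambda>n. trunc i x n - trunc j x n)" for i j
  proof -
    have "(\<lambda>n. trunc i (\<lambda>n. a * x n) n - trunc j (\<lambda>n. a * x n) n)
        = (\<lambda>n. a * (trunc i x n - trunc j x n))"
      by (auto simp: trunc_apply algebra_simps)
    then show ?thesis
      using scale_le[of "\<lambda>n. trunc i x n - trunc j x n" a] trunc_c00[of x, OF x0] c00_diff by simp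
  qed
  have "\<exists>K. \<forall>i\<ge>K. \<forall>j\<ge>K. N (\<lambda>n. trunc i (\<lambda>n. a * x n) n - trunc j (\<lambda>n. a * x n) n) < \<epsilon>"
    if "\<epsilon> > 0" for \<epsilon>
  proof -
    have "\<epsilon> / (\<bar>a\<bar> + 1) > 0" using that by (simp add: add_nonneg_pos)
    then obtain K where K: "\<And>i j. i \<ge> K \<Longrightarrow> j \<ge> K \<Longrightarrow>
        N (\<lambda>n. trunc i x n - trunc j x n) < \<epsilon> / (\<bar>a\<bar> + 1)"
      using assms unfolding CN_iff c00_Cauchy_def by meson
    have "N (\<lambda>n. trunc i (\<lambda>n. a * x n) n - trunc j (\<lambda>n. a * x n) n) < \<epsilon>" if "i \<ge> K" "j \<ge> K" for i j
    proof -
      have "\<bar>a\<bar> * N (\<lambda>n. trunc i x n - trunc j x n) \<le> \<bar>a\<bar> * (\<epsilon> / (\<bar>a\<bar> + 1))"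
        by (rule mult_left_mono) (use K[OF that] in auto)
      also have "\<dots> < \<epsilon>" using \<open>\<epsilon> > 0\<close> by (simp add: field_simps)
      finally show ?thesis using le[of i j] by linarith
    qed
    then show ?thesis by blast
  qed
  then show ?thesis unfolding CN_iff c00_Cauchy_def using trunc_c00 x0 by simp
qed

lemma CN_add:
  assumes "x \<in> CN" "y \<in> CN"
  shows "(\<lambda>n. x n + y n) \<in> CN"
proof -
  have x0: "x 0 = 0" and y0: "y 0 = 0" using CN_0 assms by auto
  have le: "N (\<lambda>n. trunc i (\<lambda>n. x n + y n) n - trunc j (\<lambda>n. x n + y n) n)
      \<le> N (\<lambda>n. trunc i x n - trunc j x n) + N (\<lambda>n. trunc i y n - trunc j y n)" for i j
  proof -
    have "(\<lambda>n. trunc i (\<lambda>n. x n + y n) n - trunc j (\<lambda>n. x n + y n) n)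
        = (\<lambda>n. (trunc i x n - trunc j x n) + (trunc i y n - trunc j y n))"
      by (auto simp: trunc_apply)
    then show ?thesis
      using add[of "\<lambda>n. trunc i x n - trunc j x n" "\<lambda>n. trunc i y n - trunc j y n"]
        trunc_c00[of x, OF x0] trunc_c00[of y, OF y0] c00_diff by simp
  qed
  have "\<exists>K. \<forall>i\<ge>K. \<forall>j\<ge>K. N (\<lambda>n. trunc i (\<lambda>n. x n + y n) n - trunc j (\<lambda>n. x n + y n) n) < \<epsilon>"
    if e: "\<epsilon> > 0" for \<epsilon>
  proof -
    have e2: "\<epsilon> / 2 > 0" using e by simp
    obtain K where K: "\<And>i j. i \<ge> K \<Longrightarrow> j \<ge> K \<Longrightarrow> N (\<lambda>n. trunc i x n - trunc j x n) < \<epsilon> / 2"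
      using assms(1) e2 unfolding CN_iff c00_Cauchy_def by meson
    obtain K' where K': "\<And>i j. i \<ge> K' \<Longrightarrow> j \<ge> K' \<Longrightarrow> N (\<lambda>n. trunc i y n - trunc j y n) < \<epsilon> / 2"
      using assms(2) e2 unfolding CN_iff c00_Cauchy_def by meson
    have "N (\<lambda>n. trunc i (\<lambda>n. x n + y n) n - trunc j (\<lambda>n. x n + y n) n) < \<epsilon>"
      if "i \<ge> max K K'" "j \<ge> max K K'" for i j
      using le[of i j] K[of i j] K'[of i j] that by auto
    then show ?thesis by blast
  qed
  then show ?thesis unfolding CN_iff c00_Cauchy_def using trunc_c00 x0 y0 by simp
qed

lemma NN_mono:
  assumes "x \<in> CN" "y \<in> CN" "\<And>n. \<bar>x n\<bar> \<le> \<bar>y n\<bar>"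
  shows "NN x \<le> NN y"
  by (rule LIMSEQ_le[OF NN_lim[OF assms(1)] NN_lim[OF assms(2)]])
    (use assms CN_0 in \<open>auto intro!: exI[of _ 0] mono trunc_c00 simp: trunc_apply\<close>)

lemma NN_add:
  assumes "x \<in> CN" "y \<in> CN"
  shows "NN (\<lambda>n. x n + y n) \<le> NN x + NN y"
proof (rule LIMSEQ_le[OF NN_lim[OF CN_add[OF assms]]
      tendsto_add[OF NN_lim[OF assms(1)] NN_lim[OF assms(2)]]])
  have "N (trunc k (\<lambda>n. x n + y n)) \<le> N (trunc k x) + N (trunc k y)" for k
  proof -
    have "trunc k (\<lambda>n. x n + y n) = (\<lambda>n. trunc k x n + trunc k y n)"
      by (auto simp: trunc_apply)
    then show ?thesis using add[of "trunc k x" "trunc k y"] trunc_c00 CN_0 assms by simp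
  qed
  then show "\<exists>M. \<forall>k\<ge>M. N (trunc k (\<lambda>n. x n + y n)) \<le> N (trunc k x) + N (trunc k y)" by blast
qed

lemma NN_scale_le:
  assumes "x \<in> CN"
  shows "NN (\<lambda>n. a * x n) \<le> \<bar>a\<bar> * NN x"
proof (rule LIMSEQ_le[OF NN_lim[OF CN_scale[OF assms]] tendsto_mult_left[OF NN_lim[OF assms]]])
  have "N (trunc k (\<lambda>n. a * x n)) \<le> \<bar>a\<bar> * N (trunc k x)" for k
  proof -
    have "trunc k (\<lambda>n. a * x n) = (\<lambda>n. a * trunc k x n)"
      by (auto simp: trunc_apply)
    then show ?thesis using scale_le[of "trunc k x" a] trunc_c00 CN_0 assms by simp
  qed
  then show "\<exists>M. \<forall>k\<ge>M. N (trunc k (\<lambda>n. a * x n)) \<le> \<bar>a\<bar> * N (trunc k x)" by blast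
qed

lemma NN_scale:
  assumes "x \<in> CN"
  shows "NN (\<lambda>n. a * x n) = \<bar>a\<bar> * NN x"
proof (cases "a = 0")
  case True
  then show ?thesis using NN_c00[OF c00_zero] zero by simp
next
  case False
  have "NN x \<le> \<bar>1 / a\<bar> * NN (\<lambda>n. a * x n)"
    using NN_scale_le[OF CN_scale[OF assms], of "1 / a" a] False by simp
  then have "\<bar>a\<bar> * NN x \<le> NN (\<lambda>n. a * x n)" using False by (simp add: field_simps)
  then show ?thesis using NN_scale_le[OF assms, of a] by simp
qed

lemma NN_coord:
  assumes "x \<in> CN" "n \<ge> 1"
  shows "\<bar>x n\<bar> \<le> NN x"
proof (rule LIMSEQ_le_const[OF NN_lim[OF assms(1)]])
  have "\<bar>x n\<bar> \<le> N (trunc k x)" if "k \<ge> n" for k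
    using coord[of "trunc k x" n] that trunc_c00[of x k] CN_0[OF assms(1)] assms
    by (simp add: trunc_apply)
  then show "\<exists>M. \<forall>k\<ge>M. \<bar>x n\<bar> \<le> N (trunc k x)" by blast
qed

lemma NN_nonneg: "x \<in> CN \<Longrightarrow> 0 \<le> NN x"
  using NN_coord[of x 1] by auto

lemma CN_sum:
  assumes "finite F" "\<And>k. k \<in> F \<Longrightarrow> x k \<in> CN"
  shows "(\<lambda>n. \<Sum>k\<in>F. x k n) \<in> CN"
  using assms by (induction F rule: finite_induct) (auto intro: CN_add c00_CN[OF c00_zero])

lemma NN_sum_le:
  assumes "finite F" "\<And>k. k \<in> F \<Longrightarrow> x k \<in> CN"
  shows "NN (\<lambda>n. \<Sum>k\<in>F. x k n) \<le> (\<Sum>k\<in>F. NN (x k))"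
  using assms
proof (induction F rule: finite_induct)
  case empty
  then show ?case by (simp add: NN_c00[OF c00_zero] zero)
next
  case (insert k F)
  have "NN (\<lambda>n. x k n + (\<Sum>k\<in>F. x k n)) \<le> NN (x k) + NN (\<lambda>n. \<Sum>k\<in>F. x k n)"
    by (rule NN_add) (use insert in \<open>auto intro: CN_sum\<close>)
  then show ?case using insert by auto
qed

text \<open>Provides the right-hand cut in the sliding hump.\<close>

lemma NN_tail:
  assumes x: "x \<in> CN" and e: "\<epsilon> > 0"
  shows "\<exists>K. \<forall>k\<ge>K. NN (\<lambda>n. x n - trunc k x n) \<le> \<epsilon>"
proof -
  have x0: "x 0 = 0" using CN_0[OF x] .
  obtain K where K: "\<And>i j. i \<ge> K \<Longrightarrow> j \<ge> K \<Longrightarrow> N (\<lambda>n. trunc i x n - trunc j x n) < \<epsilon>"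
    using assms unfolding CN_iff c00_Cauchy_def by meson
  have "NN (\<lambda>n. x n - trunc k x n) \<le> \<epsilon>" if k: "k \<ge> K" for k
  proof -
    have "(\<lambda>n. x n - trunc k x n) \<in> CN"
      by (rule CN_dominated[OF x]) (auto simp: trunc_apply)
    from NN_lim[OF this] show ?thesis
    proof (rule LIMSEQ_le_const2)
      have "N (trunc j (\<lambda>n. x n - trunc k x n)) \<le> \<epsilon>" if "j \<ge> k" for j
      proof -
        have "trunc j (\<lambda>n. x n - trunc k x n) = (\<lambda>n. trunc j x n - trunc k x n)"
          using that by (auto simp: trunc_apply)
        then show ?thesis using K[of j k] k that by simp
      qed
      then show "\<exists>M. \<forall>j\<ge>M. N (trunc j (\<lambda>n. x n - trunc k x n)) \<le> \<epsilon>" by blast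
    qed
  qed
  then show ?thesis by blast
qed

end

section \<open>Iterated norms\<close>

text \<open>
  The bound required in the first two assumptions on \<open>Nm (Suc m)\<close> holds automatically; it is a
  premise so that these facts about suprema can be checked separately for each definition.
\<close>

locale iterated_norm =
  fixes Nm :: "nat \<Rightarrow> (nat \<Rightarrow> real) \<Rightarrow> real"
    and A :: "nat \<Rightarrow> (nat \<times> (nat \<Rightarrow> nat set)) set"
    and \<theta> :: "nat \<Rightarrow> real"
  assumes theta: "n \<ge> 1 \<Longrightarrow> 0 < \<theta> n \<and> \<theta> n \<le> 1"
    and disjoint: "n \<ge> 1 \<Longrightarrow> (k, E) \<in> A n \<Longrightarrow> disjoint_family_on E {1..k}"
    and Nm_0: "Nm 0 x = sup_norm x"
    and sup_norm_le_Suc: "x \<in> c00 \<Longrightarrow>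
      (\<And>n k E. n \<ge> 1 \<Longrightarrow> (k, E) \<in> A n \<Longrightarrow> \<theta> n * (\<Sum>i\<in>{1..k}. Nm m (restr (E i) x)) \<le> B) \<Longrightarrow>
      sup_norm x \<le> Nm (Suc m) x"
    and family_le_Suc: "x \<in> c00 \<Longrightarrow>
      (\<And>n k E. n \<ge> 1 \<Longrightarrow> (k, E) \<in> A n \<Longrightarrow> \<theta> n * (\<Sum>i\<in>{1..k}. Nm m (restr (E i) x)) \<le> B) \<Longrightarrow>
      n \<ge> 1 \<Longrightarrow> (k, E) \<in> A n \<Longrightarrow> \<theta> n * (\<Sum>i\<in>{1..k}. Nm m (restr (E i) x)) \<le> Nm (Suc m) x"
    and Suc_least: "x \<in> c00 \<Longrightarrow> sup_norm x \<le> B \<Longrightarrow>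
      (\<And>n k E. n \<ge> 1 \<Longrightarrow> (k, E) \<in> A n \<Longrightarrow> \<theta> n * (\<Sum>i\<in>{1..k}. Nm m (restr (E i) x)) \<le> B) \<Longrightarrow>
      Nm (Suc m) x \<le> B"
begin

lemma family_le_l1:
  assumes "x \<in> c00" "n \<ge> 1" "(k, E) \<in> A n"
    "\<And>x. x \<in> c00 \<Longrightarrow> 0 \<le> Nm m x" "\<And>x. x \<in> c00 \<Longrightarrow> Nm m x \<le> l1 x"
  shows "\<theta> n * (\<Sum>i\<in>{1..k}. Nm m (restr (E i) x)) \<le> l1 x"
proof -
  have "\<theta> n * (\<Sum>i\<in>{1..k}. Nm m (restr (E i) x)) \<le> (\<Sum>i\<in>{1..k}. Nm m (restr (E i) x))"
    using theta[OF assms(2)] assms by (intro mult_left_le_one_le sum_nonneg) (auto intro: c00_restr)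
  also have "\<dots> \<le> (\<Sum>i\<in>{1..k}. l1 (restr (E i) x))"
    by (intro sum_mono assms c00_restr)
  also have "\<dots> \<le> l1 x"
    using assms disjoint by (intro l1_disjoint) auto
  finally show ?thesis .
qed

text \<open>Both inequalities share one induction: a finite supremum at level \<open>Suc m\<close>
  requires nonnegativity and the l_1-bound at level \<open>m\<close>.\<close>

lemma bounds: "x \<in> c00 \<Longrightarrow> sup_norm x \<le> Nm m x \<and> Nm m x \<le> l1 x"
proof (induction m arbitrary: x)
  case 0
  then show ?case by (simp add: Nm_0 sup_norm_le_l1)
next
  case (Suc m)
  have *: "\<theta> n * (\<Sum>i\<in>{1..k}. Nm m (restr (E i) x)) \<le> l1 x" if "n \<ge> 1" "(k, E) \<in> A n" for n k E
    by (rule family_le_l1[OF Suc.prems that])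
      (use Suc.IH sup_norm_nonneg in \<open>force+\<close>)
  show ?case
    using sup_norm_le_Suc[OF Suc.prems *] Suc_least[OF Suc.prems sup_norm_le_l1[OF Suc.prems] *]
    by blast
qed

lemma sup_norm_le: "x \<in> c00 \<Longrightarrow> sup_norm x \<le> Nm m x"
  and le_l1: "x \<in> c00 \<Longrightarrow> Nm m x \<le> l1 x"
  using bounds by auto

lemma Nm_nonneg: "x \<in> c00 \<Longrightarrow> 0 \<le> Nm m x"
  using sup_norm_le sup_norm_nonneg by (meson order_trans)

text \<open>The boundedness premise of \<open>family_le_Suc\<close> is discharged once and for all
  with \<open>B = l1 x\<close>.\<close>

lemma family_le:
  assumes "x \<in> c00" "n \<ge> 1" "(k, E) \<in> A n"
  shows "\<theta> n * (\<Sum>i\<in>{1..k}. Nm m (restr (E i) x)) \<le> Nm (Suc m) x"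
  by (rule family_le_Suc[OF assms(1) family_le_l1[OF assms(1)] assms(2,3)])
    (auto intro: Nm_nonneg le_l1)

lemma Nm_mono:
  "x \<in> c00 \<Longrightarrow> y \<in> c00 \<Longrightarrow> (\<And>n. \<bar>x n\<bar> \<le> \<bar>y n\<bar>) \<Longrightarrow> Nm m x \<le> Nm m y"
proof (induction m arbitrary: x y)
  case 0
  have "\<bar>x n\<bar> \<le> sup_norm y" if "n \<ge> 1" for n
    using sup_norm_upper[OF 0(2) that] 0(3)[of n] by simp
  then show ?case by (simp add: Nm_0 sup_norm_least)
next
  case (Suc m)
  show ?case
  proof (rule Suc_least[OF Suc.prems(1)])
    have "\<bar>x n\<bar> \<le> sup_norm y" if "n \<ge> 1" for n
      using sup_norm_upper[OF Suc.prems(2) that] Suc.prems(3)[of n] by simp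
    then show "sup_norm x \<le> Nm (Suc m) y"
      using sup_norm_least sup_norm_le[OF Suc.prems(2)] by (meson order_trans)
  next
    fix n k E assume n: "n \<ge> (1::nat)" and E: "(k, E) \<in> A n"
    have "\<theta> n * (\<Sum>i\<in>{1..k}. Nm m (restr (E i) x)) \<le> \<theta> n * (\<Sum>i\<in>{1..k}. Nm m (restr (E i) y))"
      using theta[OF n] Suc.prems
      by (intro mult_left_mono sum_mono Suc.IH c00_restr) (auto simp: restr_def)
    also have "\<dots> \<le> Nm (Suc m) y" by (rule family_le[OF Suc.prems(2) n E])
    finally show "\<theta> n * (\<Sum>i\<in>{1..k}. Nm m (restr (E i) x)) \<le> Nm (Suc m) y" .
  qed
qed

lemma Nm_add: "x \<in> c00 \<Longrightarrow> y \<in> c00 \<Longrightarrow> Nm m (\<lambda>n. x n + y n) \<le> Nm m x + Nm m y"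
proof (induction m arbitrary: x y)
  case 0
  then show ?case by (simp add: Nm_0 sup_norm_add)
next
  case (Suc m)
  show ?case
  proof (rule Suc_least[OF c00_add[OF Suc.prems]])
    show "sup_norm (\<lambda>n. x n + y n) \<le> Nm (Suc m) x + Nm (Suc m) y"
      using sup_norm_add[OF Suc.prems] sup_norm_le[OF Suc.prems(1), of "Suc m"]
        sup_norm_le[OF Suc.prems(2), of "Suc m"] by linarith
  next
    fix n k E assume n: "n \<ge> (1::nat)" and E: "(k, E) \<in> A n"
    have "(\<Sum>i\<in>{1..k}. Nm m (restr (E i) (\<lambda>n. x n + y n)))
        \<le> (\<Sum>i\<in>{1..k}. Nm m (restr (E i) x) + Nm m (restr (E i) y))"
      unfolding restr_add using Suc.prems by (intro sum_mono Suc.IH c00_restr)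
    then have "\<theta> n * (\<Sum>i\<in>{1..k}. Nm m (restr (E i) (\<lambda>n. x n + y n)))
        \<le> \<theta> n * (\<Sum>i\<in>{1..k}. Nm m (restr (E i) x)) + \<theta> n * (\<Sum>i\<in>{1..k}. Nm m (restr (E i) y))"
      using theta[OF n] by (simp add: sum.distrib flip: distrib_left)
    then show "\<theta> n * (\<Sum>i\<in>{1..k}. Nm m (restr (E i) (\<lambda>n. x n + y n)))
        \<le> Nm (Suc m) x + Nm (Suc m) y"
      using family_le[OF Suc.prems(1) n E, of m] family_le[OF Suc.prems(2) n E, of m] by linarith
  qed
qed

lemma Nm_scale: "x \<in> c00 \<Longrightarrow> Nm m (\<lambda>n. a * x n) \<le> \<bar>a\<bar> * Nm m x"
proof (induction m arbitrary: x)
  case 0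
  then show ?case by (simp add: Nm_0 sup_norm_scale)
next
  case (Suc m)
  show ?case
  proof (rule Suc_least[OF c00_scale[OF Suc.prems]])
    show "sup_norm (\<lambda>n. a * x n) \<le> \<bar>a\<bar> * Nm (Suc m) x"
      using sup_norm_scale[OF Suc.prems, of a] sup_norm_le[OF Suc.prems, of "Suc m"]
      by (meson abs_ge_zero mult_left_mono order_trans)
  next
    fix n k E assume n: "n \<ge> (1::nat)" and E: "(k, E) \<in> A n"
    have "(\<Sum>i\<in>{1..k}. Nm m (restr (E i) (\<lambda>n. a * x n)))
        \<le> (\<Sum>i\<in>{1..k}. \<bar>a\<bar> * Nm m (restr (E i) x))"
      unfolding restr_scale using Suc.prems by (intro sum_mono Suc.IH c00_restr)
    then have "\<theta> n * (\<Sum>i\<in>{1..k}. Nm m (restr (E i) (\<lambda>n. a * x n)))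
        \<le> \<bar>a\<bar> * (\<theta> n * (\<Sum>i\<in>{1..k}. Nm m (restr (E i) x)))"
      using theta[OF n] by (simp add: mult.left_commute flip: sum_distrib_left)
    also have "\<dots> \<le> \<bar>a\<bar> * Nm (Suc m) x"
      by (intro mult_left_mono family_le[OF Suc.prems n E]) simp
    finally show "\<theta> n * (\<Sum>i\<in>{1..k}. Nm m (restr (E i) (\<lambda>n. a * x n))) \<le> \<bar>a\<bar> * Nm (Suc m) x" .
  qed
qed

lemma lattice_norm_level: "lattice_norm (Nm m)"
proof
  show "\<bar>x n\<bar> \<le> Nm m x" if "x \<in> c00" "n \<ge> 1" for x n
    using sup_norm_upper[OF that] sup_norm_le[OF that(1), of m] by linarith
qed (fact Nm_mono Nm_add Nm_scale)+

end

locale weighted_norm = iterated_norm +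
  fixes \<alpha> :: "nat \<Rightarrow> real"
  assumes weight_pos: "n \<ge> 1 \<Longrightarrow> 0 < \<alpha> n"
    and weight_sums: "(\<lambda>n. \<alpha> (Suc n)) sums 1"
begin

definition weighted :: "(nat \<Rightarrow> real) \<Rightarrow> real" where
  "weighted x = (\<Sum>m. \<alpha> (Suc m) * Nm (Suc m) x)"

lemma weighted_summable: "x \<in> c00 \<Longrightarrow> summable (\<lambda>m. \<alpha> (Suc m) * Nm (Suc m) x)"
proof (rule summable_comparison_test[of _ "\<lambda>m. \<alpha> (Suc m) * l1 x"])
  assume x: "x \<in> c00"
  have "norm (\<alpha> (Suc n) * Nm (Suc n) x) \<le> \<alpha> (Suc n) * l1 x" for n
    using weight_pos[of "Suc n"] Nm_nonneg[OF x] le_l1[OF x] by (simp add: abs_mult mult_left_mono)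
  then show "\<exists>M. \<forall>n\<ge>M. norm (\<alpha> (Suc n) * Nm (Suc n) x) \<le> \<alpha> (Suc n) * l1 x" by blast
  show "summable (\<lambda>m. \<alpha> (Suc m) * l1 x)"
    using weight_sums by (intro summable_mult2) (auto simp: sums_iff)
qed

text \<open>As the weights sum to 1, the bound of the levels is inherited. For the norm
  \<open>phi\<close> this is, in squared form, the upper l_2-estimate of
  \<open>E_space \<beta>\<close>.\<close>

lemma weighted_le_l1:
  assumes x: "x \<in> c00"
  shows "weighted x \<le> l1 x"
proof -
  have "weighted x \<le> (\<Sum>m. \<alpha> (Suc m) * l1 x)"
    unfolding weighted_def
    using weight_pos weight_sums le_l1[OF x]
    by (intro suminf_le weighted_summable x summable_mult2)
      (auto simp: sums_iff less_imp_le intro!: mult_left_mono)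
  also have "\<dots> = l1 x"
    using weight_sums by (simp add: sums_iff flip: suminf_mult2)
  finally show ?thesis .
qed

sublocale lattice_norm weighted
proof
  fix x n assume x: "x \<in> c00" and n: "n \<ge> (1::nat)"
  have "\<bar>x n\<bar> = (\<Sum>m. \<alpha> (Suc m) * \<bar>x n\<bar>)"
    using weight_sums by (simp add: sums_iff flip: suminf_mult2)
  also have "\<dots> \<le> weighted x"
    unfolding weighted_def
    using weight_pos weight_sums sup_norm_le[OF x] sup_norm_upper[OF x n]
    by (intro suminf_le weighted_summable x summable_mult2)
      (auto simp: sums_iff less_imp_le intro!: mult_left_mono intro: order_trans)
  finally show "\<bar>x n\<bar> \<le> weighted x" .
next
  fix x y assume x: "x \<in> c00" and y: "y \<in> c00" and le: "\<And>n. \<bar>x n\<bar> \<le> \<bar>y n\<bar>"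
  show "weighted x \<le> weighted y"
    unfolding weighted_def using weight_pos
    by (intro suminf_le weighted_summable x y mult_left_mono Nm_mono le) (auto simp: less_imp_le)
next
  fix x y assume x: "x \<in> c00" and y: "y \<in> c00"
  have "weighted (\<lambda>n. x n + y n) \<le> (\<Sum>m. \<alpha> (Suc m) * Nm (Suc m) x + \<alpha> (Suc m) * Nm (Suc m) y)"
    unfolding weighted_def distrib_left[symmetric] using weight_pos
    by (intro suminf_le weighted_summable c00_add x y mult_left_mono Nm_add)
      (auto simp: less_imp_le distrib_left intro!: summable_add weighted_summable x y)
  also have "\<dots> = weighted x + weighted y"
    unfolding weighted_def by (intro suminf_add[symmetric] weighted_summable x y)
  finally show "weighted (\<lambda>n. x n + y n) \<le> weighted x + weighted y" .
next
  fix x a assume x: "x \<in> c00"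
  have "weighted (\<lambda>n. a * x n) \<le> (\<Sum>m. \<bar>a\<bar> * (\<alpha> (Suc m) * Nm (Suc m) x))"
    unfolding weighted_def mult.left_commute[of "\<bar>a\<bar>"] using weight_pos
    by (intro suminf_le weighted_summable c00_scale x mult_left_mono Nm_scale)
      (auto simp: less_imp_le mult.left_commute[of _ "\<bar>a\<bar>"] intro!: summable_mult weighted_summable x)
  also have "\<dots> = \<bar>a\<bar> * weighted x"
    unfolding weighted_def by (intro suminf_mult weighted_summable x)
  finally show "weighted (\<lambda>n. a * x n) \<le> \<bar>a\<bar> * weighted x" .
qed

text \<open>
  The weight of the level \<open>m + 1\<close> is comparable to that of the level \<open>m\<close>, so one may gain a level.
\<close>

lemma lower_estimate:
  assumes x: "x \<in> c00" and n: "n \<ge> 1" and E: "(k, E) \<in> A n"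
    and l: "0 \<le> l" "\<And>n. n \<ge> 1 \<Longrightarrow> l \<le> \<alpha> (Suc n) / \<alpha> n"
  shows "l * \<theta> n * (\<Sum>i\<in>{1..k}. weighted (restr (E i) x)) \<le> weighted x"
proof -
  have sm: "summable (\<lambda>m. \<Sum>i\<in>{1..k}. \<alpha> (Suc m) * Nm (Suc m) (restr (E i) x))"
    by (intro summable_sum weighted_summable c00_restr x)
  have "l * \<theta> n * (\<Sum>i\<in>{1..k}. weighted (restr (E i) x)) =
      l * \<theta> n * (\<Sum>m. \<Sum>i\<in>{1..k}. \<alpha> (Suc m) * Nm (Suc m) (restr (E i) x))"
    unfolding weighted_def
    by (subst suminf_sum) (auto intro: weighted_summable c00_restr x)
  also have "\<dots> = (\<Sum>m. l * \<theta> n * (\<Sum>i\<in>{1..k}. \<alpha> (Suc m) * Nm (Suc m) (restr (E i) x)))"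
    by (rule suminf_mult[symmetric, OF sm])
  also have "\<dots> \<le> (\<Sum>m. \<alpha> (Suc (Suc m)) * Nm (Suc (Suc m)) x)"
  proof (rule suminf_le)
    fix m
    have "l * \<alpha> (Suc m) \<le> \<alpha> (Suc (Suc m))"
      using l(2)[of "Suc m"] weight_pos[of "Suc m"] by (simp add: field_simps)
    moreover have "0 \<le> \<theta> n * (\<Sum>i\<in>{1..k}. Nm (Suc m) (restr (E i) x))"
      using theta[OF n] by (intro mult_nonneg_nonneg sum_nonneg Nm_nonneg c00_restr x) auto
    ultimately have "l * \<alpha> (Suc m) * (\<theta> n * (\<Sum>i\<in>{1..k}. Nm (Suc m) (restr (E i) x)))
        \<le> \<alpha> (Suc (Suc m)) * Nm (Suc (Suc m)) x"
      using family_le[OF x n E, of "Suc m"] weight_pos[of "Suc (Suc m)"] by (intro mult_mono) auto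
    then show "l * \<theta> n * (\<Sum>i\<in>{1..k}. \<alpha> (Suc m) * Nm (Suc m) (restr (E i) x))
        \<le> \<alpha> (Suc (Suc m)) * Nm (Suc (Suc m)) x"
      by (simp add: mult_ac flip: sum_distrib_left)
  next
    show "summable (\<lambda>m. l * \<theta> n * (\<Sum>i\<in>{1..k}. \<alpha> (Suc m) * Nm (Suc m) (restr (E i) x)))"
      by (rule summable_mult[OF sm])
    show "summable (\<lambda>m. \<alpha> (Suc (Suc m)) * Nm (Suc (Suc m)) x)"
      using weighted_summable[OF x] summable_Suc_iff[of "\<lambda>m. \<alpha> (Suc m) * Nm (Suc m) x"] by simp
  qed
  \<comment> \<open>Gaining a level shifts the series by one; what it loses is the nonnegative first
    term.\<close>
  also have "\<dots> = weighted x - \<alpha> (Suc 0) * Nm (Suc 0) x"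
    unfolding weighted_def using suminf_split_head[OF weighted_summable[OF x]] by simp
  also have "\<dots> \<le> weighted x"
    using weight_pos[of 1] Nm_nonneg[OF x, of 1] by simp
  finally show ?thesis .
qed

end

section \<open>The concrete norms\<close>

lemma SUP_SUP_least:
  fixes f :: "'a \<Rightarrow> 'b \<Rightarrow> real"
  assumes "I \<noteq> {}" "\<And>n. n \<in> I \<Longrightarrow> J n \<noteq> {}" "\<And>n p. n \<in> I \<Longrightarrow> p \<in> J n \<Longrightarrow> f n p \<le> B"
  shows "(SUP n\<in>I. SUP p\<in>J n. f n p) \<le> B"
  by (intro cSUP_least assms)

text \<open>For conditionally complete suprema one bound \<open>B\<close> common to all
  \<open>n\<close> is required: it bounds each inner supremum and, through these, the outer
  one.\<close>

lemma SUP_SUP_upper: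
  fixes f :: "'a \<Rightarrow> 'b \<Rightarrow> real"
  assumes "\<And>n. n \<in> I \<Longrightarrow> J n \<noteq> {}" "\<And>n p. n \<in> I \<Longrightarrow> p \<in> J n \<Longrightarrow> f n p \<le> B" "n \<in> I" "p \<in> J n"
  shows "f n p \<le> (SUP n\<in>I. SUP p\<in>J n. f n p)"
proof -
  have "f n p \<le> (SUP p\<in>J n. f n p)"
    by (rule cSUP_upper) (use assms in \<open>auto intro!: bdd_aboveI\<close>)
  also have "\<dots> \<le> (SUP n\<in>I. SUP p\<in>J n. f n p)"
  proof (rule cSUP_upper[OF assms(3)])
    have "(SUP p\<in>J n. f n p) \<le> B" if "n \<in> I" for n
      by (rule cSUP_least) (use assms that in auto)
    then show "bdd_above ((\<lambda>n. SUP p\<in>J n. f n p) ` I)" by (auto intro!: bdd_aboveI)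
  qed
  finally show ?thesis .
qed

section \<open>Admissible and allowable families\<close>

lemma empty_schreier: "{} \<in> schreier n"
proof (induction n)
  case (Suc n)
  have "\<exists>k F. {} = (\<Union>i\<in>{1..k}. F i) \<and> k \<ge> 1 \<and>
       (\<forall>i\<in>{1..k}. F i \<in> schreier n \<and> nat_le_set k (F i)) \<and>
       (\<forall>i\<in>{1..k}. \<forall>j\<in>{1..k}. i < j \<longrightarrow> set_less (F i) (F j))"
    by (intro exI[of _ 1] exI[of _ "\<lambda>_. {}"]) (simp add: Suc nat_le_set_def set_less_def)
  then show ?case by simp
qed simp

text \<open>The family of length 0 is a witness for every n, because its set of minima is
  empty.\<close>

lemma admissible_nonempty: "{(k, E). admissible n k E} \<noteq> {}"
proof -
  have "(0, \<lambda>_. {}) \<in> {(k, E). admissible n k E}"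
    by (simp add: admissible_def set_family_def empty_schreier)
  then show ?thesis by (metis empty_iff)
qed

lemma allowable_nonempty: "{(k, E). allowable n k E} \<noteq> {}"
proof -
  have "(0, \<lambda>_. {}) \<in> {(k, E). allowable n k E}"
    by (simp add: allowable_def set_family_def empty_schreier disjoint_family_on_def)
  then show ?thesis by (metis empty_iff)
qed

lemma set_less_disjoint:
  assumes "finite F" "finite G" "set_less F G"
  shows "F \<inter> G = {}"
proof (rule ccontr)
  assume "F \<inter> G \<noteq> {}"
  then obtain n where n: "n \<in> F" "n \<in> G" by blast
  then have "Max F < Min G" using assms(3) by (auto simp: set_less_def)
  then show False using Max_ge[OF assms(1) n(1)] Min_le[OF assms(2) n(2)] by simp
qed

text \<open>Through this inclusion V' and W' have the same lower estimate for admissible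
  families.\<close>

lemma admissible_allowable:
  assumes "admissible n k E"
  shows "allowable n k E"
proof -
  have "E i \<inter> E j = {}" if "i \<in> {1..k}" "j \<in> {1..k}" "i < j" for i j
    by (rule set_less_disjoint) (use assms that in \<open>auto simp: admissible_def set_family_def\<close>)
  then have "disjoint_family_on E {1..k}"
    unfolding disjoint_family_on_def by (metis Int_commute linorder_neqE_nat)
  then show ?thesis using assms by (simp add: admissible_def allowable_def)
qed

lemma V_iterated:
  assumes "\<forall>n\<ge>1. 0 < \<theta> n \<and> \<theta> n < 1"
  shows "iterated_norm (V_norm \<theta>) (\<lambda>n. {(k, E). allowable n k E}) \<theta>"
proof (rule iterated_norm.intro, goal_cases)
  \<comment> \<open>Goal 5 is \<open>family_le_Suc\<close>, whose premise supplies the common bound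
    \<open>B\<close>; goal 6 is \<open>Suc_least\<close>.\<close>
  case (5 x m B n k E)
  let ?f = "\<lambda>n (k, E). \<theta> n * (\<Sum>i\<in>{1..k}. V_norm \<theta> m (restr (E i) x))"
  have "?f n (k, E) \<le> (SUP n\<in>{1..}. SUP p\<in>{(k, E). allowable n k E}. ?f n p)"
    by (rule SUP_SUP_upper[where B = B and f = ?f])
      (use 5 in \<open>auto intro: allowable_nonempty[simplified]\<close>)
  then show ?case by (simp add: le_max_iff_disj)
next
  case (6 x B m)
  show ?case
    unfolding V_norm.simps
    by (intro max.boundedI SUP_SUP_least allowable_nonempty 6(2)) (use 6(3) in auto)
qed (use assms in \<open>auto simp: allowable_def\<close>)

text \<open>A family of constraints that changes type at \<open>s\<close> merges the two suprema of
  \<open>W_norm\<close>. The first ranges over \<open>{1..s}\<close>, which is nonempty by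
  \<open>1 <= s\<close>, so upper bounds may be checked termwise.\<close>

lemma W_iterated:
  assumes "\<forall>n\<ge>1. 0 < \<theta> n \<and> \<theta> n < 1" and s: "s \<ge> 1"
  shows "iterated_norm (W_norm \<theta> s)
    (\<lambda>n. if n \<le> s then {(k, E). allowable n k E} else {(k, E). admissible n k E}) \<theta>"
proof (rule iterated_norm.intro, goal_cases)
  case (2 n k E)
  then show ?case using admissible_allowable by (auto simp: allowable_def split: if_splits)
next
  case (5 x m B n k E)
  let ?f = "\<lambda>n (k, E). \<theta> n * (\<Sum>i\<in>{1..k}. W_norm \<theta> s m (restr (E i) x))"
  show ?case
  proof (cases "n \<le> s")
    case True
    have "?f n (k, E) \<le> (SUP n\<in>{1..s}. SUP p\<in>{(k, E). allowable n k E}. ?f n p)"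
      by (rule SUP_SUP_upper[where B = B and f = ?f])
        (use 5 True in \<open>auto intro: allowable_nonempty[simplified]\<close>)
    then show ?thesis by (simp add: le_max_iff_disj)
  next
    case False
    have "?f n (k, E) \<le> (SUP n\<in>{s+1..}. SUP p\<in>{(k, E). admissible n k E}. ?f n p)"
      by (rule SUP_SUP_upper[where B = B and f = ?f])
        (use 5 False in \<open>auto intro: admissible_nonempty[simplified]\<close>)
    then show ?thesis by (simp add: le_max_iff_disj)
  qed
next
  case (6 x B m)
  show ?case
    unfolding W_norm.simps
    by (intro max.boundedI SUP_SUP_least allowable_nonempty admissible_nonempty 6(2))
      (use 6(3) s in \<open>auto split: if_splits\<close>)
qed (use assms in auto)

text \<open>
  \<open>phi\<close> is the norm of which \<open>E_norm\<close> is the \<open>2\<close>-convexification. Including the supremum norm does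
  not change it, but allows treating all norms alike.
\<close>

fun phi :: "nat \<Rightarrow> (nat \<Rightarrow> real) \<Rightarrow> real" where
  "phi 0 x = sup_norm x"
| "phi (Suc m) x = max (sup_norm x)
     (SUP (k, E)\<in>{(k, E). admissible 1 k E}. \<Sum>i\<in>{1..k}. phi m (restr (E i) x))"

text \<open>The index n is a dummy here: every n carries the S_1-admissible families with factor 1,
  which is why the locale allows \<open>\<theta> n = 1\<close>.\<close>

lemma phi_iterated: "iterated_norm phi (\<lambda>n. {(k, E). admissible 1 k E}) (\<lambda>n. 1)"
proof (rule iterated_norm.intro, goal_cases)
  case (2 n k E)
  then show ?case using admissible_allowable by (auto simp: allowable_def)
next
  case (5 x m B n k E)
  let ?f = "\<lambda>(k, E). \<Sum>i\<in>{1..k}. phi m (restr (E i) x)"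
  have "?f (k, E) \<le> (SUP p\<in>{(k, E). admissible 1 k E}. ?f p)"
  proof (rule cSUP_upper)
    show "bdd_above (?f ` {(k, E). admissible 1 k E})"
      using 5(2)[of 1] by (auto intro!: bdd_aboveI)
  qed (use 5 in simp)
  then show ?case by (simp add: le_max_iff_disj)
next
  case (6 x B m)
  show ?case
    unfolding phi.simps
    by (intro max.boundedI cSUP_least admissible_nonempty 6(2)) (use 6(3)[of 1] in auto)
qed auto

interpretation phi: iterated_norm phi "\<lambda>n. {(k, E). admissible 1 k E}" "\<lambda>n. 1"
  by (rule phi_iterated)

section \<open>Convexification and the square of Edgington's norm\<close>

lemma singleton_schreier_1: "n \<ge> 1 \<Longrightarrow> {n} \<in> schreier 1"
proof -
  assume n: "n \<ge> 1"
  have "\<exists>k F. {n} = (\<Union>i\<in>{1..k}. F i) \<and> k \<ge> 1 \<and>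
       (\<forall>i\<in>{1..k}. F i \<in> schreier 0 \<and> nat_le_set k (F i)) \<and>
       (\<forall>i\<in>{1..k}. \<forall>j\<in>{1..k}. i < j \<longrightarrow> set_less (F i) (F j))"
    by (intro exI[of _ 1] exI[of _ "\<lambda>_. {n}"]) (use n in \<open>simp add: nat_le_set_def\<close>)
  then show "{n} \<in> schreier 1" by (simp only: One_nat_def schreier.simps) simp
qed

lemma sup_norm_power2:
  assumes x: "x \<in> c00"
  shows "sup_norm (\<lambda>n. (x n)\<^sup>2) = (sup_norm x)\<^sup>2"
proof (rule antisym)
  show "sup_norm (\<lambda>n. (x n)\<^sup>2) \<le> (sup_norm x)\<^sup>2"
  proof (rule sup_norm_least)
    fix n :: nat assume "n \<ge> 1"
    from power_mono[OF sup_norm_upper[OF x this] abs_ge_zero, of 2]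
    show "\<bar>(x n)\<^sup>2\<bar> \<le> (sup_norm x)\<^sup>2" by simp
  qed
  have "sup_norm x \<le> sqrt (sup_norm (\<lambda>n. (x n)\<^sup>2))"
    by (rule sup_norm_least)
      (use sup_norm_upper[OF c00_power2[OF x]] in \<open>auto intro: real_le_rsqrt\<close>)
  then show "(sup_norm x)\<^sup>2 \<le> sup_norm (\<lambda>n. (x n)\<^sup>2)"
    using sup_norm_nonneg[OF x] sup_norm_nonneg[OF c00_power2[OF x]]
    by (metis power_mono real_sqrt_pow2)
qed

lemma restr_power2: "(\<lambda>n. (restr E x n)\<^sup>2) = restr E (\<lambda>n. (x n)\<^sup>2)"
  by (auto simp: restr_def)

lemma E_norm_power2: "x \<in> c00 \<Longrightarrow> (E_norm m x)\<^sup>2 = phi m (\<lambda>n. (x n)\<^sup>2)"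
proof (induction m arbitrary: x)
  case 0
  then show ?case by (simp add: sup_norm_power2)
next
  case (Suc m)
  let ?y = "\<lambda>n. (x n)\<^sup>2"
  let ?J = "{(k, E). admissible 1 k E}"
  let ?f = "\<lambda>(k, E). \<Sum>i\<in>{1..k::nat}. phi m (restr (E i) ?y)"
  have y: "?y \<in> c00" by (rule c00_power2[OF Suc.prems])
  have ub: "?f p \<le> Sup (?f ` ?J)" if "p \<in> ?J" for p
  proof (rule cSUP_upper[OF that])
    show "bdd_above (?f ` ?J)"
      using phi.family_le[OF y order_refl, of _ _ m] by (auto intro!: bdd_aboveI)
  qed
  \<comment> \<open>The one-set family \<open>{n}\<close> is S_1-admissible, so the supremum over
    families dominates every coordinate and the maximum in \<open>phi\<close> equals that
    supremum.\<close>
  have "sup_norm ?y \<le> Sup (?f ` ?J)"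
  proof (rule sup_norm_least)
    fix n :: nat assume n: "n \<ge> 1"
    have "(1, \<lambda>_. {n}) \<in> ?J"
      using n singleton_schreier_1 by (simp add: admissible_def set_family_def)
    from ub[OF this] have "phi m (restr {n} ?y) \<le> Sup (?f ` ?J)" by simp
    moreover have "\<bar>restr {n} ?y n\<bar> \<le> phi m (restr {n} ?y)"
      using sup_norm_upper[OF c00_restr[OF y] n] phi.sup_norm_le[OF c00_restr[OF y]]
      by (meson order_trans)
    ultimately show "\<bar>?y n\<bar> \<le> Sup (?f ` ?J)" by (simp add: restr_def)
  qed
  moreover have "(E_norm (Suc m) x)\<^sup>2 = (sqrt (Sup (?f ` ?J)))\<^sup>2"
  proof -
    have "(\<Sum>i\<in>{1..k}. (E_norm m (restr (E i) x))\<^sup>2) = (\<Sum>i\<in>{1..k}. phi m (restr (E i) ?y))" for k E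
      using Suc.IH[OF c00_restr[OF Suc.prems]] by (simp add: restr_power2)
    then have "(\<lambda>(k, E). \<Sum>i\<in>{1..k}. (E_norm m (restr (E i) x))\<^sup>2) = ?f"
      by (intro ext) (simp only: split_beta)
    then show ?thesis by (simp only: E_norm.simps)
  qed
  moreover have "0 \<le> Sup (?f ` ?J)"
    using calculation(1) sup_norm_nonneg[OF y] by linarith
  ultimately show ?case by simp
qed

text \<open>The triangle inequality is the point: a pointwise convexity inequality for squares is
  fed into \<open>N\<close>, with weights chosen so that the result is the square of the sum of the
  two norms.\<close>

lemma (in lattice_norm) convexification_norm: "lattice_norm (\<lambda>x. sqrt (N (\<lambda>n. (x n)\<^sup>2)))"
proof
  fix x n assume x: "x \<in> c00" and n: "n \<ge> (1::nat)"
  show "\<bar>x n\<bar> \<le> sqrt (N (\<lambda>n. (x n)\<^sup>2))"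
    using coord[OF c00_power2[OF x] n] by (intro real_le_rsqrt) simp
next
  fix x y assume x: "x \<in> c00" and y: "y \<in> c00" and le: "\<And>n. \<bar>x n\<bar> \<le> \<bar>y n\<bar>"
  show "sqrt (N (\<lambda>n. (x n)\<^sup>2)) \<le> sqrt (N (\<lambda>n. (y n)\<^sup>2))"
    using mono[OF c00_power2[OF x] c00_power2[OF y]] le by (simp add: abs_le_square_iff)
next
  fix x a assume x: "x \<in> c00"
  have "N (\<lambda>n. (a * x n)\<^sup>2) \<le> a\<^sup>2 * N (\<lambda>n. (x n)\<^sup>2)"
    using scale_le[OF c00_power2[OF x], of "a\<^sup>2"] by (simp add: power_mult_distrib)
  then have "sqrt (N (\<lambda>n. (a * x n)\<^sup>2)) \<le> sqrt (a\<^sup>2 * N (\<lambda>n. (x n)\<^sup>2))" by simp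
  then show "sqrt (N (\<lambda>n. (a * x n)\<^sup>2)) \<le> \<bar>a\<bar> * sqrt (N (\<lambda>n. (x n)\<^sup>2))"
    by (simp add: real_sqrt_mult)
next
  fix x y assume x: "x \<in> c00" and y: "y \<in> c00"
  define p where "p = sqrt (N (\<lambda>n. (x n)\<^sup>2))"
  define q where "q = sqrt (N (\<lambda>n. (y n)\<^sup>2))"
  have pq: "0 \<le> p" "0 \<le> q" "N (\<lambda>n. (x n)\<^sup>2) = p\<^sup>2" "N (\<lambda>n. (y n)\<^sup>2) = q\<^sup>2"
    unfolding p_def q_def using nonneg c00_power2 x y by auto
  have "sqrt (N (\<lambda>n. (x n + y n)\<^sup>2)) \<le> p + q + e" if e: "e > 0" for e
  proof -
    \<comment> \<open>The summand \<open>e / 2\<close> keeps the divisors positive when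
      \<open>p\<close> or \<open>q\<close> is 0.\<close>
    define P where "P = p + e / 2"
    define Q where "Q = q + e / 2"
    have P: "P > 0" "Q > 0" "p \<le> P" "q \<le> Q" using pq e by (auto simp: P_def Q_def)
    text \<open>Convexity of the square, with weights proportional to \<open>P\<close> and \<open>Q\<close>.\<close>
    have sq: "(s + t)\<^sup>2 \<le> (P + Q) / P * s\<^sup>2 + (P + Q) / Q * t\<^sup>2" for s t :: real
    proof -
      have "(P + Q) / P * s\<^sup>2 + (P + Q) / Q * t\<^sup>2 - (s + t)\<^sup>2 = (Q * s - P * t)\<^sup>2 / (P * Q)"
        using P by (simp add: field_simps power2_eq_square)
      moreover have "0 \<le> (Q * s - P * t)\<^sup>2 / (P * Q)" using P by simp
      ultimately show ?thesis by linarith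
    qed
    have c: "(\<lambda>n. (P + Q) / P * (x n)\<^sup>2) \<in> c00" "(\<lambda>n. (P + Q) / Q * (y n)\<^sup>2) \<in> c00"
      by (intro c00_scale c00_power2 x y)+
    have "N (\<lambda>n. (x n + y n)\<^sup>2) \<le> N (\<lambda>n. (P + Q) / P * (x n)\<^sup>2 + (P + Q) / Q * (y n)\<^sup>2)"
      by (rule mono[OF c00_power2[OF c00_add[OF x y]] c00_add[OF c]])
        (use sq abs_ge_self order_trans in \<open>simp, blast\<close>)
    also have "\<dots> \<le> N (\<lambda>n. (P + Q) / P * (x n)\<^sup>2) + N (\<lambda>n. (P + Q) / Q * (y n)\<^sup>2)"
      by (rule add[OF c])
    also have "\<dots> \<le> \<bar>(P + Q) / P\<bar> * p\<^sup>2 + \<bar>(P + Q) / Q\<bar> * q\<^sup>2"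
      using scale_le[OF c00_power2[OF x], of "(P + Q) / P"]
        scale_le[OF c00_power2[OF y], of "(P + Q) / Q"] pq by simp
    also have "\<dots> \<le> (P + Q) / P * P\<^sup>2 + (P + Q) / Q * Q\<^sup>2"
      using P pq by (intro add_mono mult_mono power_mono) auto
    also have "\<dots> = (P + Q)\<^sup>2" using P by (simp add: field_simps power2_eq_square)
    finally have "sqrt (N (\<lambda>n. (x n + y n)\<^sup>2)) \<le> P + Q"
      using P by (intro real_le_lsqrt) auto
    then show ?thesis by (simp add: P_def Q_def)
  qed
  then show "sqrt (N (\<lambda>n. (x n + y n)\<^sup>2)) \<le> sqrt (N (\<lambda>n. (x n)\<^sup>2)) + sqrt (N (\<lambda>n. (y n)\<^sup>2))"
    unfolding p_def q_def by (rule field_le_epsilon)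
qed

section \<open>Vectors with small \<open>phi\<close> supported on Schreier sets\<close>

lemma admissible_Min_mono:
  assumes "admissible n k E" "i \<in> {1..k}" "j \<in> {1..k}" "i < j"
  shows "Min (E i) < Min (E j)"
proof -
  have "finite (E i)" "E i \<noteq> {}" "E j \<noteq> {}" "set_less (E i) (E j)"
    using assms by (auto simp: admissible_def set_family_def)
  then have "Min (E i) \<le> Max (E i)" "Max (E i) < Min (E j)"
    by (auto simp: set_less_def)
  then show ?thesis by simp
qed

text \<open>The familiar description of S_1 by "cardinality at most minimum": the \<open>k\<close>
  minima are distinct and lie in a union of \<open>r\<close> sets with at most one element each, so
  \<open>k <= r\<close>, while \<open>r\<close> is below every minimum.\<close>

lemma admissible_1_le_Min:
  assumes E: "admissible 1 k E" and i: "i \<in> {1..k}"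
  shows "k \<le> Min (E i)"
proof -
  let ?M = "\<lambda>i. Min (E i)"
  have "?M ` {1..k} \<in> schreier (Suc 0)" using E by (simp add: admissible_def)
  then obtain r F where eq: "?M ` {1..k} = (\<Union>j\<in>{1..r}. F j)"
    and F: "\<forall>j\<in>{1..r}. F j \<in> schreier 0 \<and> nat_le_set r (F j)"
    by (auto simp only: schreier.simps)
  have F1: "F j = {} \<or> (\<exists>n. F j = {n})" if "j \<in> {1..r}" for j
    using F that by auto
  have "inj_on ?M {1..k}"
    by (rule linorder_inj_onI') (use admissible_Min_mono[OF E] in \<open>simp add: less_imp_neq\<close>)
  then have "k = card (?M ` {1..k})" by (simp add: card_image)
  also have "\<dots> \<le> (\<Sum>j\<in>{1..r}. card (F j))"
    unfolding eq by (rule card_UN_le) simp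
  also have "\<dots> \<le> (\<Sum>j\<in>{1..r}. 1)"
    by (rule sum_mono) (use F1 in fastforce)
  finally have "k \<le> r" by simp
  moreover obtain j where j: "j \<in> {1..r}" "?M i \<in> F j" using eq i by blast
  moreover have "F j = {?M i}" using F1[OF j(1)] j(2) by auto
  ultimately show ?thesis using F j by (force simp: nat_le_set_def)
qed

section \<open>Combinations of unit vectors and repeated averages\<close>

text \<open>Coefficients are indexed by \<open>k\<close>, not by the position \<open>i k\<close>, so
  that the same \<open>a\<close> and \<open>F\<close> also serve for the blocks.\<close>

definition comb :: "(nat \<Rightarrow> nat) \<Rightarrow> (nat \<Rightarrow> real) \<Rightarrow> nat set \<Rightarrow> nat \<Rightarrow> real" where
  "comb i a F = (\<lambda>n. \<Sum>k\<in>F. a k * unit_vec (i k) n)"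

lemma comb_c00: "finite F \<Longrightarrow> (\<And>k. i k \<ge> 1) \<Longrightarrow> comb i a F \<in> c00"
  unfolding comb_def by (intro c00_sum c00_scale c00_unit_vec)

lemma comb_at:
  assumes "finite F" "inj i" "k \<in> F"
  shows "comb i a F (i k) = a k"
proof -
  have "comb i a F (i k) = (\<Sum>j\<in>F. if j = k then a j else 0)"
    unfolding comb_def by (rule sum.cong) (use assms in \<open>auto simp: unit_vec_def inj_eq\<close>)
  then show ?thesis using assms by simp
qed

lemma comb_off: "n \<notin> i ` F \<Longrightarrow> comb i a F n = 0"
  unfolding comb_def by (rule sum.neutral) (auto simp: unit_vec_def)

lemma l1_comb:
  assumes "finite F" "inj i"
  shows "l1 (comb i a F) = (\<Sum>k\<in>F. \<bar>a k\<bar>)"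
proof -
  have "l1 (comb i a F) = (\<Sum>n\<in>i ` F. \<bar>comb i a F n\<bar>)"
    by (rule l1_eq_sum) (use assms comb_off in auto)
  also have "\<dots> = (\<Sum>k\<in>F. \<bar>comb i a F (i k)\<bar>)"
    by (rule sum.reindex_cong[OF _ refl]) (use assms in \<open>auto intro: inj_on_subset\<close>)
  also have "\<dots> = (\<Sum>k\<in>F. \<bar>a k\<bar>)"
    by (rule sum.cong) (use assms comb_at in auto)
  finally show ?thesis .
qed

lemma comb_power2:
  assumes "finite F" "inj i"
  shows "(\<lambda>n. (comb i a F n)\<^sup>2) = comb i (\<lambda>k. (a k)\<^sup>2) F"
proof
  fix n
  show "(comb i a F n)\<^sup>2 = comb i (\<lambda>k. (a k)\<^sup>2) F n"
    by (cases "n \<in> i ` F") (use assms in \<open>auto simp: comb_at comb_off\<close>)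
qed

text \<open>By \<open>uniq\<close> no two of the values exceed \<open>d\<close>; the possible
  exception contributes at most 1.\<close>

lemma sum_le_with_exception:
  fixes c :: "nat \<Rightarrow> real"
  assumes fin: "finite J" and le: "\<And>j. j \<in> J \<Longrightarrow> c j \<le> 1" and d: "0 \<le> d"
    and uniq: "\<And>j j'. j \<in> J \<Longrightarrow> j' \<in> J \<Longrightarrow> j < j' \<Longrightarrow> c j > d \<Longrightarrow> c j' \<le> d"
  shows "(\<Sum>j\<in>J. c j) \<le> 1 + real (card J) * d"
proof (cases "\<exists>j\<in>J. c j > d")
  case True
  then obtain j where j: "j \<in> J" "c j > d" by blast
  have "c j' \<le> d" if "j' \<in> J - {j}" for j'
    using uniq[of j j'] uniq[of j' j] j that by (cases j j' rule: linorder_cases) fastforce+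
  then have "(\<Sum>j'\<in>J - {j}. c j') \<le> (\<Sum>j'\<in>J - {j}. d)" by (rule sum_mono)
  also have "\<dots> \<le> real (card J) * d" using d fin by (simp add: mult_right_mono card_mono)
  finally show ?thesis using sum.remove[OF fin j(1), of c] le[OF j(1)] by linarith
next
  case False
  then have "(\<Sum>j\<in>J. c j) \<le> (\<Sum>j\<in>J. d)" by (intro sum_mono) force
  then show ?thesis by simp
qed

text \<open>An average of order n + 1 is the mean of q successive averages of order n supported
  beyond q. If an S_1-admissible family meets one of them, its length is at most the last position
  of that vector, and the later vectors were chosen too small for so few sets to matter. Hence at
  most one vector contributes more than \<open>\<epsilon> / 2\<close>, and it contributes at most
  its l_1-norm 1. Each round of averaging gains one level of \<open>phi\<close>.\<close>

lemma small_average_exists: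
  fixes i p :: "nat \<Rightarrow> nat"
  assumes i: "strict_mono i" and p: "strict_mono p" and i1: "\<And>k. i k \<ge> 1" and p1: "\<And>k. p k \<ge> 1"
    and "\<epsilon> > 0"
  shows "\<exists>F a. finite F \<and> F \<noteq> {} \<and> F \<subseteq> {L..} \<and> (\<forall>k. 0 \<le> a k) \<and> (\<forall>k. k \<notin> F \<longrightarrow> a k = 0) \<and>
    (\<Sum>k\<in>F. a k) = 1 \<and> p ` F \<in> schreier n \<and> (\<forall>m<n. phi m (comb i a F) \<le> \<epsilon>)"
  using \<open>\<epsilon> > 0\<close>
proof (induction n arbitrary: L \<epsilon>)
  case 0
  show ?case
    by (intro exI[of _ "{L}"] exI[of _ "\<lambda>k. if k = L then 1 else 0"]) (use p1[of L] in simp)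
next
  case (Suc n)
  have inj: "inj i" by (rule strict_mono_imp_inj_on[OF i])
  \<comment> \<open>The share \<open>1 / q\<close> of the exceptional vector is to be at most
    \<open>\<epsilon> / 2\<close>.\<close>
  obtain q0 :: nat where q0: "2 / \<epsilon> < real q0" using reals_Archimedean2 by blast
  define q where "q = Suc q0"
  have q1: "q \<ge> 1" and q: "1 / real q \<le> \<epsilon> / 2"
    using q0 \<open>\<epsilon> > 0\<close> by (auto simp: q_def field_simps)
  \<comment> \<open>In \<open>max L q\<close>, the bound \<open>L\<close> places the support as
    demanded, and \<open>q\<close>, together with \<open>k <= p k\<close>, gives the Schreier
    condition for a union of q sets.\<close>
  define good where "good F a \<longleftrightarrow> finite F \<and> F \<noteq> {} \<and> F \<subseteq> {max L q..} \<and> (\<forall>k. 0 \<le> a k) \<and>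
    (\<forall>k. k \<notin> F \<longrightarrow> a k = 0) \<and> (\<Sum>k\<in>F. a k) = 1 \<and> p ` F \<in> schreier n"
    for F and a :: "nat \<Rightarrow> real"
  text \<open>
    The bound for each vector beats the number of sets in an \<open>S\<^sub>1\<close>-admissible family which
    meets one of the previous vectors.
  \<close>
  define next_bound where "next_bound F = \<epsilon> / (2 * (1 + real (i (Max F))))" for F
  have next_pos: "next_bound F > 0" for F
    using \<open>\<epsilon> > 0\<close> by (simp add: next_bound_def add_pos_nonneg)
  have "\<exists>f. \<forall>j. good (fst (f j)) (snd (f j)) \<and>
      (fst (f (Suc j)) \<subseteq> {Suc (Max (fst (f j)))..} \<and>
       (\<forall>m<n. phi m (comb i (snd (f (Suc j))) (fst (f (Suc j)))) \<le> next_bound (fst (f j))))"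
  proof (rule dependent_nat_choice)
    \<comment> \<open>Smallness is asked only relative to a predecessor, so the starting vector may
      have any tolerance, here 1.\<close>
    obtain F a where "good F a" using Suc.IH[of 1 "max L q"] by (auto simp: good_def)
    then show "\<exists>x. good (fst x) (snd x)" by auto
  next
    fix x :: "nat set \<times> (nat \<Rightarrow> real)" and j :: nat
    define L' where "L' = max (Suc (Max (fst x))) (max L q)"
    have L': "{L'..} \<subseteq> {Suc (Max (fst x))..}" "{L'..} \<subseteq> {max L q..}" by (auto simp: L'_def)
    obtain F' a' where "good F' a'" "F' \<subseteq> {Suc (Max (fst x))..}"
      "\<forall>m<n. phi m (comb i a' F') \<le> next_bound (fst x)"
      using Suc.IH[OF next_pos, of L' "fst x"] subset_trans[OF _ L'(1)] subset_trans[OF _ L'(2)]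
      unfolding good_def by metis
    then show "\<exists>y. good (fst y) (snd y) \<and> fst y \<subseteq> {Suc (Max (fst x))..} \<and>
        (\<forall>m<n. phi m (comb i (snd y) (fst y)) \<le> next_bound (fst x))"
      by (intro exI[of _ "(F', a')"]) simp
  qed
  then obtain f where f: "\<And>j. good (fst (f j)) (snd (f j))"
    "\<And>j. fst (f (Suc j)) \<subseteq> {Suc (Max (fst (f j)))..}"
    "\<And>j m. m < n \<Longrightarrow> phi m (comb i (snd (f (Suc j))) (fst (f (Suc j)))) \<le> next_bound (fst (f j))"
    by blast
  define F where "F j = fst (f j)" for j
  define a where "a j = snd (f j)" for j
  have good: "good (F j) (a j)" for j using f(1)[of j] by (simp add: F_def a_def)
  have fin: "finite (F j)" and ne: "F j \<noteq> {}" and FL: "F j \<subseteq> {max L q..}"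
    and a0: "0 \<le> a j k" and asum: "(\<Sum>k\<in>F j. a j k) = 1"
    and pF: "p ` F j \<in> schreier n" for j k
    using good[of j] unfolding good_def by simp_all
  have aoff: "a j k = 0" if "k \<notin> F j" for j k
    using good[of j] that unfolding good_def by simp
  have step: "F (Suc j) \<subseteq> {Suc (Max (F j))..}"
    and small: "m < n \<Longrightarrow> phi m (comb i (a (Suc j)) (F (Suc j))) \<le> next_bound (F j)" for j m
    using f(2)[of j] f(3)[of m j] by (simp_all add: F_def a_def)
  have "Max (F j) < Max (F (Suc j))" for j
    using step[of j] Max_in[OF fin[of "Suc j"] ne[of "Suc j"]] by auto
  then have "mono (\<lambda>j. Max (F j))" by (intro strict_mono_mono) (simp add: strict_mono_Suc_iff)
  then have Max_mono: "Max (F j) \<le> Max (F j')" if "j \<le> j'" for j j'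
    using that by (rule monoD)
  have less: "k < k'" if "j < j'" "k \<in> F j" "k' \<in> F j'" for j j' k k'
  proof -
    obtain j'' where j'': "j' = Suc j''" "j \<le> j''" using \<open>j < j'\<close> by (cases j') auto
    have "k \<le> Max (F j)" using fin that by simp
    also have "\<dots> \<le> Max (F j'')" by (rule Max_mono[OF j''(2)])
    also have "\<dots> < k'" using step[of j''] that j'' by auto
    finally show ?thesis .
  qed
  define z where "z j = comb i (a j) (F j)" for j
  have zc: "z j \<in> c00" for j unfolding z_def by (rule comb_c00[OF fin i1])
  have zl1: "l1 (z j) = 1" for j
    unfolding z_def l1_comb[OF fin inj] using a0 asum by simp
  have zsmall: "phi m (z j') \<le> \<epsilon> / (2 * (1 + real (i (Max (F j)))))" if "j < j'" "m < n" for j j' m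
  proof -
    obtain j'' where j'': "j' = Suc j''" "j \<le> j''" using \<open>j < j'\<close> by (cases j') auto
    have "i (Max (F j)) \<le> i (Max (F j''))"
      using i Max_mono[OF j''(2)] by (simp add: strict_mono_less_eq)
    then have "next_bound (F j'') \<le> \<epsilon> / (2 * (1 + real (i (Max (F j)))))"
      unfolding next_bound_def using \<open>\<epsilon> > 0\<close> by (intro frac_le) (simp_all add: add_pos_nonneg)
    then show ?thesis using small[OF \<open>m < n\<close>, of j''] by (simp add: z_def j'')
  qed
  define J where "J = {1..q}"
  define G where "G = (\<Union>j\<in>J. F j)"
  define b where "b k = (\<Sum>j\<in>J. 1 / real q * a j k)" for k
  have finJ: "finite J" and cardJ: "card J = q" by (auto simp: J_def)
  have finG: "finite G" using fin by (simp add: G_def finJ)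
  \<comment> \<open>The test function \<open>h\<close> has two uses: \<open>unit_vec (i k) x\<close>
    identifies \<open>w\<close> as the mean of the \<open>z j\<close>, and the constant 1 yields the
    total mass of \<open>b\<close>.\<close>
  have sumG: "(\<Sum>k\<in>G. b k * h k) = (\<Sum>j\<in>J. 1 / real q * (\<Sum>k\<in>F j. a j k * h k))" for h :: "nat \<Rightarrow> real"
  proof -
    have "(\<Sum>k\<in>G. b k * h k) = (\<Sum>k\<in>G. \<Sum>j\<in>J. 1 / real q * (a j k * h k))"
      by (simp add: b_def sum_distrib_right)
    also have "\<dots> = (\<Sum>j\<in>J. 1 / real q * (\<Sum>k\<in>G. a j k * h k))"
      by (subst sum.swap) (simp add: sum_distrib_left)
    also have "\<dots> = (\<Sum>j\<in>J. 1 / real q * (\<Sum>k\<in>F j. a j k * h k))"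
    proof (rule sum.cong[OF refl])
      fix j assume "j \<in> J"
      then have "(\<Sum>k\<in>G. a j k * h k) = (\<Sum>k\<in>F j. a j k * h k)"
        by (intro sum.mono_neutral_right finG) (auto simp: G_def aoff)
      then show "1 / real q * (\<Sum>k\<in>G. a j k * h k) = 1 / real q * (\<Sum>k\<in>F j. a j k * h k)"
        by simp
    qed
    finally show ?thesis .
  qed
  define w where "w = comb i b G"
  have w: "w = (\<lambda>x. \<Sum>j\<in>J. 1 / real q * z j x)"
    unfolding w_def z_def comb_def by (intro ext sumG)
  have wc: "w \<in> c00" unfolding w_def by (rule comb_c00[OF finG i1])
  have z_nonneg: "0 \<le> z j x" for j x
    unfolding z_def comb_def using a0 by (intro sum_nonneg mult_nonneg_nonneg) (auto simp: unit_vec_def)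
  \<comment> \<open>Applied to the coordinates of the \<open>z j\<close>, where disjoint supports
    leave one nonzero value, and to their sums over an admissible family.\<close>
  have average: "(\<Sum>j\<in>J. 1 / real q * c j) \<le> \<epsilon>"
    if "\<And>j. j \<in> J \<Longrightarrow> c j \<le> 1"
      "\<And>j j'. j \<in> J \<Longrightarrow> j' \<in> J \<Longrightarrow> j < j' \<Longrightarrow> c j > \<epsilon> / 2 \<Longrightarrow> c j' \<le> \<epsilon> / 2" for c
  proof -
    have "(\<Sum>j\<in>J. 1 / real q * c j) = 1 / real q * (\<Sum>j\<in>J. c j)" by (rule sum_distrib_left[symmetric])
    also have "\<dots> \<le> 1 / real q * (1 + real (card J) * (\<epsilon> / 2))"
    proof (rule mult_left_mono)
      show "(\<Sum>j\<in>J. c j) \<le> 1 + real (card J) * (\<epsilon> / 2)"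
        by (rule sum_le_with_exception[OF finJ that(1) _ that(2)]) (use \<open>\<epsilon> > 0\<close> in simp_all)
    qed simp
    also have "\<dots> = 1 / real q + \<epsilon> / 2" using q1 by (simp add: cardJ field_simps)
    finally show ?thesis using q by simp
  qed
  have wsup: "sup_norm w \<le> \<epsilon>"
  proof (rule sup_norm_least)
    fix x :: nat assume "x \<ge> 1"
    have "(\<Sum>j\<in>J. 1 / real q * z j x) \<le> \<epsilon>"
    proof (rule average)
      show "z j x \<le> 1" for j using abs_le_l1[OF zc[of j], of x] by (simp add: zl1)
      fix j j' assume jj: "j < j'" and "z j x > \<epsilon> / 2"
      then have "z j x \<noteq> 0" using \<open>\<epsilon> > 0\<close> by auto
      then have "x \<in> i ` F j" unfolding z_def using comb_off by blast
      moreover have "F j \<inter> F j' = {}" using less[OF jj] by blast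
      then have "x \<notin> i ` F j'" if "x \<in> i ` F j"
        using that by (auto simp: inj_eq[OF inj])
      ultimately have "z j' x = 0" unfolding z_def by (intro comb_off) blast
      then show "z j' x \<le> \<epsilon> / 2" using \<open>\<epsilon> > 0\<close> by simp
    qed
    then show "\<bar>w x\<bar> \<le> \<epsilon>" unfolding w using z_nonneg by (simp add: sum_nonneg)
  qed
  have wphi: "phi m w \<le> \<epsilon>" if m: "m < Suc n" for m
  proof (cases m)
    case 0
    then show ?thesis using wsup by simp
  next
    case (Suc m')
    then have m': "m' < n" using m by simp
    interpret level: lattice_norm "phi m'" by (rule phi.lattice_norm_level)
    have "(\<Sum>r\<in>{1..k}. phi m' (restr (E r) w)) \<le> \<epsilon>" if E: "admissible 1 k E" for k E
    proof -
      define t where "t j = (\<Sum>r\<in>{1..k}. phi m' (restr (E r) (z j)))" for j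
      have "phi m' (restr (E r) w) \<le> (\<Sum>j\<in>J. 1 / real q * phi m' (restr (E r) (z j)))" for r
      proof -
        have "restr (E r) w = (\<lambda>x. \<Sum>j\<in>J. 1 / real q * restr (E r) (z j) x)"
          by (auto simp: restr_def w)
        then have "phi m' (restr (E r) w) \<le> (\<Sum>j\<in>J. phi m' (\<lambda>x. 1 / real q * restr (E r) (z j) x))"
          using level.sum_le[OF finJ, of "\<lambda>j x. 1 / real q * restr (E r) (z j) x"]
            c00_scale[OF c00_restr[OF zc]] by presburger
        also have "\<dots> \<le> (\<Sum>j\<in>J. 1 / real q * phi m' (restr (E r) (z j)))"
          using level.scale_le[OF c00_restr[OF zc], of "1 / real q"] by (intro sum_mono) simp
        finally show ?thesis .
      qed
      then have "(\<Sum>r\<in>{1..k}. phi m' (restr (E r) w))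
          \<le> (\<Sum>r\<in>{1..k}. \<Sum>j\<in>J. 1 / real q * phi m' (restr (E r) (z j)))"
        by (rule sum_mono)
      also have "\<dots> = (\<Sum>j\<in>J. 1 / real q * t j)"
        unfolding t_def by (subst sum.swap) (simp add: sum_distrib_left)
      also have "\<dots> \<le> \<epsilon>"
      proof (rule average)
        show "t j \<le> 1" for j
          using phi.family_le_l1[OF zc[of j], of 1 k E m'] E phi.Nm_nonneg phi.le_l1
          by (simp add: t_def zl1)
        fix j j' assume jj: "j < j'" and "t j > \<epsilon> / 2"
        then have "t j \<noteq> 0" using \<open>\<epsilon> > 0\<close> by auto
        \<comment> \<open>Some set of the family meets the support of \<open>z j\<close>; its
          minimum, which bounds the length \<open>k\<close>, is therefore at most
          \<open>i (Max (F j))\<close>.\<close>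
        then obtain r where r: "r \<in> {1..k}" "phi m' (restr (E r) (z j)) \<noteq> 0"
          unfolding t_def using sum.neutral by meson
        have "restr (E r) (z j) \<noteq> (\<lambda>x. 0)" using r(2) level.zero by auto
        then obtain x where x: "x \<in> E r" "z j x \<noteq> 0"
          by (auto simp: restr_def fun_eq_iff split: if_splits)
        then obtain \<kappa> where \<kappa>: "\<kappa> \<in> F j" "x = i \<kappa>" unfolding z_def using comb_off by blast
        have "k \<le> Min (E r)" by (rule admissible_1_le_Min[OF E r(1)])
        also have "\<dots> \<le> x"
          using E r(1) x(1) by (intro Min_le) (auto simp: admissible_def set_family_def)
        also have "\<dots> \<le> i (Max (F j))"
          unfolding \<kappa>(2) using i \<kappa>(1) fin by (simp add: strict_mono_less_eq)
        finally have k: "k \<le> i (Max (F j))" .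
        \<comment> \<open>A crude bound suffices: each of the few sets may see all of
          \<open>z j'\<close>.\<close>
        have "t j' \<le> (\<Sum>r\<in>{1..k}. phi m' (z j'))"
          unfolding t_def
          by (intro sum_mono level.mono c00_restr zc) (auto simp: restr_def)
        also have "\<dots> = real k * phi m' (z j')" by simp
        also have "\<dots> \<le> real k * (\<epsilon> / (2 * (1 + real (i (Max (F j))))))"
          by (rule mult_left_mono[OF zsmall[OF jj m']]) simp
        also have "\<dots> \<le> (1 + real (i (Max (F j)))) * (\<epsilon> / (2 * (1 + real (i (Max (F j))))))"
          using k \<open>\<epsilon> > 0\<close> by (intro mult_right_mono) auto
        also have "\<dots> = \<epsilon> / 2"
        proof -
          have "b * (\<epsilon> / (2 * b)) = \<epsilon> / 2" if "b > 0" for b :: real using that by simp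
          then show ?thesis by (meson add_pos_nonneg of_nat_0_le_iff zero_less_one)
        qed
        finally show "t j' \<le> \<epsilon> / 2" .
      qed
      finally show ?thesis .
    qed
    then show ?thesis unfolding Suc by (intro phi.Suc_least[OF wc wsup]) simp
  qed
  have pG: "p ` G \<in> schreier (Suc n)"
  proof -
    have eq: "p ` G = (\<Union>j\<in>{1..q}. p ` F j)" by (auto simp: G_def J_def)
    have "nat_le_set q (p ` F j)" for j
    proof -
      have "q \<le> p k" if "k \<in> F j" for k
        using FL[of j] that strict_mono_imp_increasing[OF p, of k] by force
      then show ?thesis unfolding nat_le_set_def using fin ne by simp
    qed
    moreover have "set_less (p ` F j) (p ` F j')" if "j < j'" for j j'
    proof -
      have "p k < p k'" if "k \<in> F j" "k' \<in> F j'" for k k'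
        using less[OF \<open>j < j'\<close> that] p by (simp add: strict_mono_less)
      then show ?thesis unfolding set_less_def using fin ne by simp
    qed
    ultimately show ?thesis
      unfolding eq schreier.simps using q1 pF by blast
  qed
  have "(\<Sum>k\<in>G. b k) = 1"
    using sumG[of "\<lambda>_. 1"] asum q1 by (simp add: cardJ)
  moreover have "G \<noteq> {}" using ne q1 by (auto simp: G_def J_def)
  moreover have "G \<subseteq> {L..}" using FL by (fastforce simp: G_def)
  moreover have "0 \<le> b k" for k unfolding b_def using a0 by (intro sum_nonneg) simp
  moreover have "b k = 0" if "k \<notin> G" for k
    unfolding b_def using that aoff by (intro sum.neutral) (auto simp: G_def)
  ultimately show ?case
    using finG pG wphi unfolding w_def by (intro exI[of _ G] exI[of _ b]) auto
qed

section \<open>A sliding hump\<close>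

text \<open>For a given left cut \<open>q\<close>, coordinatewise convergence makes the part up to
  \<open>q\<close> small for some late \<open>g i\<close>; for this fixed \<open>g i\<close> the
  tail is then cut off. Consecutive windows are adjacent, and the errors are summable with total at
  most \<open>\<eta>\<close>.\<close>

lemma (in lattice_norm) sliding_hump:
  assumes g: "\<And>i. i \<ge> 1 \<Longrightarrow> g i \<in> CN" and g0: "\<And>n. (\<lambda>i. g i n) \<longlonglongrightarrow> 0" and "\<eta> > 0"
  obtains i q :: "nat \<Rightarrow> nat" where "strict_mono i" "strict_mono q" "\<And>k. i k \<ge> 1"
    "\<And>k. NN (restr (- {q k<..q (Suc k)}) (g (i k))) \<le> \<eta> * (1 / 2) ^ Suc k"
proof -
  have ex: "\<exists>i>i0. \<exists>q'>q. NN (restr (- {q<..q'}) (g i)) \<le> e" if e: "e > 0" for i0 q e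
  proof -
    \<comment> \<open>The shift avoids the index 0, for which membership of \<open>g 0\<close> is
      not assumed.\<close>
    have "(\<lambda>k. N (trunc q (g (Suc k)))) \<longlonglongrightarrow> 0"
      by (rule trunc_tendsto_zero) (use g CN_0 LIMSEQ_Suc[OF g0] in auto)
    then have "\<forall>\<^sub>F k in sequentially. N (trunc q (g (Suc k))) < e / 2"
      using e by (intro order_tendstoD(2)) auto
    then obtain k where k: "k \<ge> i0" "N (trunc q (g (Suc k))) < e / 2"
      using eventually_happens[OF eventually_conj[OF _ eventually_ge_at_top[of i0]]] by force
    define i where "i = Suc k"
    have gi: "g i \<in> CN" using g by (simp add: i_def)
    obtain K where K: "\<And>r. r \<ge> K \<Longrightarrow> NN (\<lambda>n. g i n - trunc r (g i) n) \<le> e / 2"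
      using NN_tail[OF gi, of "e / 2"] e by auto
    define q' where "q' = max K (Suc q)"
    have tc: "trunc q (g i) \<in> c00" using CN_0[OF gi] by (rule trunc_c00)
    have tail: "(\<lambda>n. g i n - trunc q' (g i) n) \<in> CN"
      by (rule CN_dominated[OF gi]) (simp add: trunc_apply)
    have "restr (- {q<..q'}) (g i) = (\<lambda>n. trunc q (g i) n + (g i n - trunc q' (g i) n))"
      by (intro ext) (auto simp: restr_def trunc_apply q'_def)
    then have "NN (restr (- {q<..q'}) (g i)) \<le> NN (trunc q (g i)) + NN (\<lambda>n. g i n - trunc q' (g i) n)"
      using NN_add[OF c00_CN[OF tc] tail] by simp
    also have "\<dots> \<le> e"
      using K[of q'] k(2) by (simp add: NN_c00[OF tc] q'_def flip: i_def)
    finally show ?thesis using k(1) by (intro exI[of _ i] conjI exI[of _ q']) (auto simp: i_def q'_def)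
  qed
  have pos: "\<eta> * (1 / 2) ^ Suc k > 0" for k using \<open>\<eta> > 0\<close> by simp
  \<comment> \<open>A state holds the chosen index and both ends of its window, so that the next
    window can start at \<open>q'\<close>.\<close>
  define P where "P k x \<longleftrightarrow> (case x of (i, q, q') \<Rightarrow> i \<ge> (1::nat) \<and> q < q' \<and>
    NN (restr (- {q<..q'}) (g i)) \<le> \<eta> * (1 / 2) ^ Suc k)" for k x
  have "\<exists>f. \<forall>k. P k (f k) \<and> fst (f k) < fst (f (Suc k)) \<and> fst (snd (f (Suc k))) = snd (snd (f k))"
  proof (rule dependent_nat_choice)
    obtain i q' where "i > 0" "q' > 0" "NN (restr (- {0<..q'}) (g i)) \<le> \<eta> * (1 / 2) ^ Suc 0"
      using ex[OF pos] by blast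
    then show "\<exists>x. P 0 x" by (intro exI[of _ "(i, 0, q')"]) (simp add: P_def)
    fix x k
    obtain i q' where "i > fst x" "q' > snd (snd x)"
      "NN (restr (- {snd (snd x)<..q'}) (g i)) \<le> \<eta> * (1 / 2) ^ Suc (Suc k)"
      using ex[OF pos] by blast
    then show "\<exists>y. P (Suc k) y \<and> fst x < fst y \<and> fst (snd y) = snd (snd x)"
      by (intro exI[of _ "(i, snd (snd x), q')"]) (auto simp: P_def)
  qed
  then obtain f where f: "\<And>k. P k (f k)" "\<And>k. fst (f k) < fst (f (Suc k))"
    "\<And>k. fst (snd (f (Suc k))) = snd (snd (f k))" by blast
  show ?thesis
  proof (rule that[of "\<lambda>k. fst (f k)" "\<lambda>k. fst (snd (f k))"])
    show "strict_mono (\<lambda>k. fst (f k))" using f(2) by (simp add: strict_mono_Suc_iff)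
    have "fst (snd (f k)) < snd (snd (f k))" for k using f(1)[of k] by (simp add: P_def split_beta)
    then show "strict_mono (\<lambda>k. fst (snd (f k)))" using f(3) by (simp add: strict_mono_Suc_iff)
    show "fst (f k) \<ge> 1" for k using f(1)[of k] by (simp add: P_def split_beta)
    show "NN (restr (- {fst (snd (f k))<..fst (snd (f (Suc k)))}) (g (fst (f k)))) \<le> \<eta> * (1 / 2) ^ Suc k" for k
      using f(1)[of k] f(3)[of k] by (simp add: P_def split_beta)
  qed
qed

lemma increasing_enumeration:
  fixes F :: "nat set"
  assumes "finite F"
  obtains h where "bij_betw h {1..card F} F"
    "\<And>r r'. r \<in> {1..card F} \<Longrightarrow> r' \<in> {1..card F} \<Longrightarrow> r < r' \<Longrightarrow> h r < h r'"
proof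
  let ?xs = "sorted_list_of_set F"
  let ?h = "\<lambda>r. ?xs ! (r - 1)"
  have len: "length ?xs = card F" by simp
  have less: "?h r < ?h r'" if "r \<in> {1..card F}" "r' \<in> {1..card F}" "r < r'" for r r'
    using that len by (intro sorted_wrt_nth_less[OF strict_sorted_list_of_set]) auto
  show "\<And>r r'. r \<in> {1..card F} \<Longrightarrow> r' \<in> {1..card F} \<Longrightarrow> r < r' \<Longrightarrow> ?h r < ?h r'"
    by (rule less)
  have inj: "inj_on ?h {1..card F}"
    by (rule linorder_inj_onI') (use less in \<open>simp add: less_imp_neq\<close>)
  have "?h ` {1..card F} \<subseteq> F"
  proof
    fix y assume "y \<in> ?h ` {1..card F}"
    then obtain r where "r \<in> {1..card F}" "y = ?h r" by blast
    then have "y \<in> set ?xs" using len by (auto intro!: nth_mem)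
    then show "y \<in> F" using assms by simp
  qed
  then have "?h ` {1..card F} = F"
    using inj assms by (intro card_subset_eq) (simp_all add: card_image)
  then show "bij_betw ?h {1..card F} F" using inj by (simp add: bij_betw_def)
qed

section \<open>The comparison with Edgington's space\<close>

lemma lattice_norm_cong:
  assumes "lattice_norm N" "\<And>x. x \<in> c00 \<Longrightarrow> N' x = N x"
  shows "lattice_norm N'"
proof -
  interpret lattice_norm N by (rule assms)
  show ?thesis
    by unfold_locales (use assms(2) coord mono add scale_le c00_add c00_scale in auto)
qed

text \<open>Take n-th roots: \<open>K powr (1 / n)\<close> tends to 1, so the limit of the roots
  would be at most \<open>v\<close>.\<close>

lemma no_geometric_decay:
  assumes "0 < K" "0 < v" "v < 1" "\<And>n. n \<ge> 1 \<Longrightarrow> 0 < \<theta> n" "\<And>n. n \<ge> 1 \<Longrightarrow> \<theta> n \<le> K * v ^ n"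
    "(\<lambda>n. \<theta> n powr (1 / real n)) \<longlonglongrightarrow> 1"
  shows False
proof -
  have "(\<lambda>n. K powr (1 / real n) * v) \<longlonglongrightarrow> K powr 0 * v"
    by (intro tendsto_intros lim_1_over_n) (use \<open>0 < K\<close> in auto)
  moreover have "\<theta> n powr (1 / real n) \<le> K powr (1 / real n) * v" if "n \<ge> 1" for n
  proof -
    have "\<theta> n powr (1 / real n) \<le> (K * v ^ n) powr (1 / real n)"
      using assms(4,5)[OF that] by (intro powr_mono2) auto
    also have "\<dots> = K powr (1 / real n) * v"
      using assms(1,2) that by (simp add: powr_mult powr_powr flip: powr_realpow)
    finally show ?thesis .
  qed
  ultimately have "1 \<le> K powr 0 * v"
    using assms(6) by (intro LIMSEQ_le[of "\<lambda>n. \<theta> n powr (1 / real n)"]) auto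
  then show False using assms(1,3) by simp
qed

text \<open>The assumption \<open>lower\<close> is what V' and W' have in common; \<open>v\<close>
  is a ratio bound for \<open>\<beta>\<close>, making its weights geometrically small.\<close>

locale comparison =
  X: lattice_norm N + P: weighted_norm phi "\<lambda>n. {(k, E). admissible 1 k E}" "\<lambda>n. 1" \<beta>
  for N :: "(nat \<Rightarrow> real) \<Rightarrow> real" and \<beta> :: "nat \<Rightarrow> real" +
  fixes \<theta> :: "nat \<Rightarrow> real" and l v :: real
  assumes lower: "x \<in> c00 \<Longrightarrow> n \<ge> 1 \<Longrightarrow> admissible n k E \<Longrightarrow>
      l * \<theta> n * (\<Sum>i\<in>{1..k}. N (restr (E i) x)) \<le> N x"
    and l: "l > 0" and \<theta>: "n \<ge> 1 \<Longrightarrow> 0 < \<theta> n"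
    and \<beta>1: "\<beta> 1 \<le> 1" and \<beta>v: "n \<ge> 1 \<Longrightarrow> \<beta> (Suc n) \<le> v * \<beta> n" and v: "0 < v" "v < 1"
begin

lemma weight_le: "\<beta> (Suc m) \<le> v ^ m"
proof (induction m)
  case 0
  then show ?case using \<beta>1 by simp
next
  case (Suc m)
  have "\<beta> (Suc (Suc m)) \<le> v * \<beta> (Suc m)" by (rule \<beta>v) simp
  also have "\<dots> \<le> v * v ^ m" using Suc v by simp
  finally show ?case by simp
qed

text \<open>Levels 1 to n cost at most \<open>\<epsilon>\<close>, since the total weight is 1. On
  the higher levels \<open>phi\<close> is at most the l_1-norm, and the weights are dominated by a
  geometric series.\<close>

lemma weighted_tail:
  assumes z: "z \<in> c00" "l1 z \<le> 1" and e: "\<epsilon> \<ge> 0" and small: "\<And>m. m < Suc n \<Longrightarrow> phi m z \<le> \<epsilon>"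
  shows "P.weighted z \<le> \<epsilon> + v ^ n / (1 - v)"
proof -
  define t where "t m = (if m < n then 0 else v ^ m)" for m
  have "(\<lambda>m. v ^ n * v ^ m) sums (v ^ n * (1 / (1 - v)))"
    using v by (intro sums_mult geometric_sums) auto
  then have "(\<lambda>m. t (m + n)) sums (v ^ n / (1 - v))"
    by (simp add: t_def power_add mult.commute)
  then have t: "t sums (v ^ n / (1 - v))"
    by (subst (asm) sums_zero_iff_shift) (auto simp: t_def)
  have b: "(\<lambda>m. \<beta> (Suc m) * \<epsilon>) sums (1 * \<epsilon>)"
    by (rule sums_mult2[OF P.weight_sums])
  have sums: "(\<lambda>m. \<beta> (Suc m) * \<epsilon> + t m) sums (\<epsilon> + v ^ n / (1 - v))"
    using sums_add[OF b t] by simp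
  have "\<beta> (Suc m) * phi (Suc m) z \<le> \<beta> (Suc m) * \<epsilon> + t m" for m
  proof (cases "m < n")
    case True
    then show ?thesis
      using P.weight_pos[of "Suc m"] small[of "Suc m"] by (simp add: t_def mult_left_mono)
  next
    case False
    have "\<beta> (Suc m) * phi (Suc m) z \<le> v ^ m * 1"
      using weight_le[of m] phi.le_l1[OF z(1), of "Suc m"] phi.Nm_nonneg[OF z(1), of "Suc m"] z(2) v
      by (intro mult_mono) auto
    moreover have "0 \<le> \<beta> (Suc m) * \<epsilon>" using P.weight_pos[of "Suc m"] e by simp
    ultimately show ?thesis using False by (simp add: t_def)
  qed
  then have "P.weighted z \<le> (\<Sum>m. \<beta> (Suc m) * \<epsilon> + t m)"
    unfolding P.weighted_def using sums_summable[OF sums]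
    by (intro suminf_le P.weighted_summable z)
  also have "\<dots> = \<epsilon> + v ^ n / (1 - v)" by (rule sums_unique[OF sums, symmetric])
  finally show ?thesis .
qed

text \<open>Here \<open>x i\<close> is the image of the \<open>i\<close>-th unit vector under an isomorphism from \<open>E_space \<beta>\<close>.\<close>

lemma theta_decay:
  assumes g: "\<And>i. i \<ge> 1 \<Longrightarrow> (\<lambda>n. (x i n)\<^sup>2) \<in> X.CN"
    and null: "\<And>n. (\<lambda>i. x i n) \<longlonglongrightarrow> 0"
    and d: "\<And>i. i \<ge> 1 \<Longrightarrow> d \<le> X.NN (\<lambda>n. (x i n)\<^sup>2)"
    and M: "\<And>F b i. finite F \<Longrightarrow> inj i \<Longrightarrow> (\<And>k. i k \<ge> 1) \<Longrightarrow>
      (\<lambda>n. (\<Sum>k\<in>F. b k * x (i k) n)\<^sup>2) \<in> X.CN \<and>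
      X.NN (\<lambda>n. (\<Sum>k\<in>F. b k * x (i k) n)\<^sup>2) \<le> M * P.weighted (comb i (\<lambda>k. (b k)\<^sup>2) F)"
    and M0: "M \<ge> 0"
  shows "l * \<theta> (Suc n) * d \<le> 2 * M * (v ^ n / (1 - v))"
proof -
  \<comment> \<open>One \<open>\<eta>\<close> measures both the hump errors and the smallness of the
    average; it tends to 0 with n fixed.\<close>
  have approx: "l * \<theta> (Suc n) * (d - \<eta>) \<le> 2 * (M * (\<eta> + v ^ n / (1 - v))) + 2 * \<eta>" if \<eta>: "\<eta> > 0" for \<eta>
  proof -
    define g where "g i = (\<lambda>n. (x i n)\<^sup>2)" for i
    have gC: "g i \<in> X.CN" if "i \<ge> 1" for i using g[OF that] by (simp add: g_def)
    have gn: "(\<lambda>i. g i n) \<longlonglongrightarrow> 0" for n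
      unfolding g_def using tendsto_power[OF null, of n 2] by simp
    obtain i q :: "nat \<Rightarrow> nat" where i: "strict_mono i" and q: "strict_mono q" and i1: "\<And>k. i k \<ge> 1"
      and off: "\<And>k. X.NN (restr (- {q k<..q (Suc k)}) (g (i k))) \<le> \<eta> * (1 / 2) ^ Suc k"
      using X.sliding_hump[of g, OF gC gn \<eta>] by blast
    have inj: "inj i" by (rule strict_mono_imp_inj_on[OF i])
    define I where "I k = {q k<..q (Suc k)}" for k
    have qS: "q k < q (Suc k)" for k using q by (simp add: strict_mono_less)
    have I_less: "a < b" if "k < k'" "a \<in> I k" "b \<in> I k'" for a b k k'
    proof -
      have "q (Suc k) \<le> q k'" using q that(1) by (simp add: strict_mono_less_eq)
      then show ?thesis using that by (simp add: I_def)
    qed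
    have I_disjoint: "k = k'" if "j \<in> I k" "j \<in> I k'" for j k k'
      using I_less[of k k' j j] I_less[of k' k j j] that by (metis less_irrefl linorder_neqE_nat)
    have MinI: "Min (I k) = Suc (q k)" for k
      using qS[of k] by (intro Min_eqI) (auto simp: I_def)
    have I_fin: "finite (I k)" and I_ne: "I k \<noteq> {}" for k
      using qS[of k] by (auto simp: I_def)
    \<comment> \<open>The two sequences part here: \<open>phi\<close> is small at the positions
      \<open>i k\<close>, while the Schreier condition concerns \<open>Suc (q k)\<close>, the
      minimum of the window \<open>I k\<close>.\<close>
    obtain F a where F: "finite F" and a0: "\<And>k. 0 \<le> a k" and asum: "(\<Sum>k\<in>F. a k) = 1"
      and pF: "(\<lambda>k. Suc (q k)) ` F \<in> schreier (Suc n)"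
      and small: "\<And>m. m < Suc n \<Longrightarrow> phi m (comb i a F) \<le> \<eta>"
      using small_average_exists[OF i, of "\<lambda>k. Suc (q k)" \<eta> 0 "Suc n"] q i1 \<eta>
      by (auto simp: strict_mono_def)
    have combc: "comb i a F \<in> c00" by (rule comb_c00[OF F i1])
    have \<Phi>: "P.weighted (comb i a F) \<le> \<eta> + v ^ n / (1 - v)"
      by (rule weighted_tail[OF combc _ _ small])
        (use \<eta> a0 asum in \<open>auto simp: l1_comb[OF F inj]\<close>)
    \<comment> \<open>This is the image of the combination with coefficients
      \<open>sqrt (a k)\<close>, whose coordinatewise square is \<open>comb i a F\<close>.\<close>
    define w where "w j = (\<Sum>k\<in>F. sqrt (a k) * x (i k) j)" for j
    have wC: "(\<lambda>j. (w j)\<^sup>2) \<in> X.CN"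
      and w: "X.NN (\<lambda>j. (w j)\<^sup>2) \<le> M * P.weighted (comb i a F)"
      using M[OF F inj i1, of "\<lambda>k. sqrt (a k)"] a0 by (auto simp: w_def)
    define R where "R k = restr (- I k) (g (i k))" for k
    have RC: "R k \<in> X.CN" for k
      unfolding R_def by (rule X.CN_dominated[OF gC[OF i1[of k]]]) (simp add: restr_def)
    have R0: "0 \<le> R k j" for k j by (simp add: R_def restr_def g_def)
    define B where "B k = restr (I k) (g (i k))" for k
    have Bc: "B k \<in> c00" for k
      unfolding c00_def B_def restr_def
      by (auto simp: I_def intro!: finite_subset[of _ "I k"])
    have B_norm: "d - \<eta> \<le> N (B k)" for k
    proof -
      have "g (i k) = (\<lambda>j. B k j + R k j)" by (intro ext) (simp add: B_def R_def restr_def)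
      then have "X.NN (g (i k)) \<le> N (B k) + X.NN (R k)"
        using X.NN_add[OF X.c00_CN[OF Bc] RC] X.NN_c00[OF Bc] by metis
      moreover have "X.NN (R k) \<le> \<eta> * (1 / 2) ^ Suc k"
        using off[of k] by (simp only: R_def I_def)
      moreover have "\<eta> * (1 / 2) ^ Suc k \<le> \<eta> * 1"
        using \<eta> by (intro mult_left_mono power_le_one) auto
      ultimately show ?thesis using d[OF i1, of k] by (simp add: g_def)
    qed
    \<comment> \<open>Unlike the square of \<open>w\<close>, the vector \<open>Y\<close> is finitely
      supported and free of cross terms, so \<open>lower\<close> applies and its blocks are
      explicit.\<close>
    define Y where "Y j = (\<Sum>k\<in>F. a k * B k j)" for j
    have Yc: "Y \<in> c00" unfolding Y_def by (intro c00_sum c00_scale Bc F)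
    have Y_at: "Y j = a k * g (i k) j" if "k \<in> F" "j \<in> I k" for j k
    proof -
      have "Y j = (\<Sum>k'\<in>F. if k' = k then a k * g (i k) j else 0)"
        unfolding Y_def
        by (rule sum.cong) (use that I_disjoint in \<open>auto simp: B_def restr_def\<close>)
      then show ?thesis using that F by simp
    qed
    have Y_off: "Y j = 0" if "\<And>k. k \<in> F \<Longrightarrow> j \<notin> I k" for j
      unfolding Y_def by (rule sum.neutral) (use that in \<open>auto simp: B_def restr_def\<close>)
    have Y0: "0 \<le> Y j" for j
      unfolding Y_def using a0 by (intro sum_nonneg mult_nonneg_nonneg) (auto simp: B_def restr_def g_def)
    \<comment> \<open>In the window of \<open>k\<close> the main term is \<open>w j - r\<close>,
      where \<open>r\<close> collects the other vectors. They are off their own windows there, and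
      Cauchy-Schwarz with total mass at most 1 bounds the square of \<open>r\<close> by the sum of
      the \<open>R k\<close>.\<close>
    have bound: "Y j \<le> 2 * (w j)\<^sup>2 + 2 * (\<Sum>k\<in>F. R k j)" for j
    proof (cases "\<exists>k\<in>F. j \<in> I k")
      case True
      then obtain k where k: "k \<in> F" "j \<in> I k" by blast
      define r where "r = (\<Sum>k'\<in>F - {k}. sqrt (a k') * x (i k') j)"
      have "w j = sqrt (a k) * x (i k) j + r"
        unfolding w_def r_def by (rule sum.remove[OF F k(1)])
      then have "Y j = (w j - r)\<^sup>2"
        using Y_at[OF k] a0[of k] by (simp add: power_mult_distrib g_def)
      also have "\<dots> \<le> 2 * (w j)\<^sup>2 + 2 * r\<^sup>2"
        using zero_le_power2[of "w j + r"] by (simp add: power2_eq_square algebra_simps)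
      finally have "Y j \<le> 2 * (w j)\<^sup>2 + 2 * r\<^sup>2" .
      moreover have "r\<^sup>2 \<le> (\<Sum>k\<in>F. R k j)"
      proof -
        have "r\<^sup>2 \<le> (\<Sum>k'\<in>F - {k}. (sqrt (a k'))\<^sup>2) * (\<Sum>k'\<in>F - {k}. (x (i k') j)\<^sup>2)"
          unfolding r_def by (rule Cauchy_Schwarz_ineq_sum)
        also have "\<dots> \<le> 1 * (\<Sum>k'\<in>F - {k}. (x (i k') j)\<^sup>2)"
        proof (intro mult_right_mono sum_nonneg)
          have "(\<Sum>k'\<in>F - {k}. (sqrt (a k'))\<^sup>2) = (\<Sum>k'\<in>F - {k}. a k')" using a0 by simp
          also have "\<dots> \<le> (\<Sum>k'\<in>F. a k')" using F a0 by (intro sum_mono2) auto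
          finally show "(\<Sum>k'\<in>F - {k}. (sqrt (a k'))\<^sup>2) \<le> 1" using asum by simp
        qed simp
        also have "\<dots> = (\<Sum>k'\<in>F - {k}. R k' j)"
          unfolding mult_1
          by (rule sum.cong) (use k(2) I_disjoint in \<open>auto simp: R_def restr_def g_def\<close>)
        also have "\<dots> \<le> (\<Sum>k\<in>F. R k j)" using F R0 by (intro sum_mono2) auto
        finally show ?thesis .
      qed
      ultimately show ?thesis by linarith
    next
      case False
      then have "Y j = 0" using Y_off by blast
      then show ?thesis using R0 by (simp add: sum_nonneg)
    qed
    have sumRC: "(\<lambda>j. \<Sum>k\<in>F. R k j) \<in> X.CN" by (rule X.CN_sum[OF F RC])
    have "N Y = X.NN Y" by (rule X.NN_c00[OF Yc, symmetric])
    also have "\<dots> \<le> X.NN (\<lambda>j. 2 * (w j)\<^sup>2 + 2 * (\<Sum>k\<in>F. R k j))"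
      by (rule X.NN_mono[OF X.c00_CN[OF Yc] X.CN_add[OF X.CN_scale[OF wC] X.CN_scale[OF sumRC]]])
        (use bound Y0 in \<open>metis abs_of_nonneg abs_ge_self order_trans\<close>)
    also have "\<dots> \<le> 2 * X.NN (\<lambda>j. (w j)\<^sup>2) + 2 * X.NN (\<lambda>j. \<Sum>k\<in>F. R k j)"
      using X.NN_add[OF X.CN_scale[OF wC, of 2] X.CN_scale[OF sumRC, of 2]]
        X.NN_scale[OF wC, of 2] X.NN_scale[OF sumRC, of 2] by simp
    also have "\<dots> \<le> 2 * (M * (\<eta> + v ^ n / (1 - v))) + 2 * \<eta>"
    proof -
      have "X.NN (\<lambda>j. \<Sum>k\<in>F. R k j) \<le> (\<Sum>k\<in>F. X.NN (R k))" by (rule X.NN_sum_le[OF F RC])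
      also have "\<dots> \<le> (\<Sum>k\<in>F. \<eta> * (1 / 2) ^ Suc k)"
        using off by (intro sum_mono) (simp only: R_def I_def)
      also have "\<dots> \<le> \<eta>"
      proof -
        have s: "(\<lambda>k. \<eta> * (1 / 2) ^ Suc k) sums (\<eta> * 1)"
          by (intro sums_mult power_half_series)
        have "(\<Sum>k\<in>F. \<eta> * (1 / 2) ^ Suc k) \<le> (\<Sum>k. \<eta> * (1 / 2) ^ Suc k)"
          by (rule sum_le_suminf[OF sums_summable[OF s] F]) (use \<eta> in simp)
        then show ?thesis using sums_unique[OF s] by simp
      qed
      finally have "X.NN (\<lambda>j. \<Sum>k\<in>F. R k j) \<le> \<eta>" .
      moreover have "M * P.weighted (comb i a F) \<le> M * (\<eta> + v ^ n / (1 - v))"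
        by (rule mult_left_mono[OF \<Phi> M0])
      ultimately show ?thesis using w by linarith
    qed
    finally have upper: "N Y \<le> 2 * (M * (\<eta> + v ^ n / (1 - v))) + 2 * \<eta>" .
    obtain h where h: "bij_betw h {1..card F} F"
      and h_less: "\<And>r r'. r \<in> {1..card F} \<Longrightarrow> r' \<in> {1..card F} \<Longrightarrow> r < r' \<Longrightarrow> h r < h r'"
      using increasing_enumeration[OF F] by blast
    \<comment> \<open>The windows, rather than the supports of the blocks, form the family: their
      minima are exactly the points \<open>Suc (q k)\<close> for which \<open>F\<close> was
      chosen.\<close>
    have adm: "admissible (Suc n) (card F) (\<lambda>r. I (h r))"
      unfolding admissible_def
    proof (intro conjI ballI impI)
      show "set_family (card F) (\<lambda>r. I (h r))"
        unfolding set_family_def using I_fin I_ne by (auto simp: I_def)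
      show "set_less (I (h r)) (I (h r'))"
        if "r \<in> {1..card F}" "r' \<in> {1..card F}" "r < r'" for r r'
        unfolding set_less_def using I_less[OF h_less[OF that]] I_fin I_ne by simp
      have "(\<lambda>r. Min (I (h r))) ` {1..card F} = (\<lambda>k. Suc (q k)) ` (h ` {1..card F})"
        by (auto simp: MinI)
      also have "\<dots> = (\<lambda>k. Suc (q k)) ` F" using h by (simp add: bij_betw_def)
      finally show "(\<lambda>r. Min (I (h r))) ` {1..card F} \<in> schreier (Suc n)" using pF by simp
    qed
    have "(\<Sum>r\<in>{1..card F}. N (restr (I (h r)) Y)) = (\<Sum>k\<in>F. N (restr (I k) Y))"
      by (rule sum.reindex_bij_betw[OF h])
    also have "\<dots> \<ge> (\<Sum>k\<in>F. a k * (d - \<eta>))"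
    proof (rule sum_mono)
      fix k assume k: "k \<in> F"
      have "restr (I k) Y = (\<lambda>j. a k * B k j)"
        using Y_at[OF k] by (intro ext) (simp add: restr_def B_def)
      moreover have "N (\<lambda>j. a k * B k j) = a k * N (B k)"
        using X.NN_scale[OF X.c00_CN[OF Bc], of "a k" k] a0[of k]
        by (simp add: X.NN_c00 Bc c00_scale)
      ultimately show "a k * (d - \<eta>) \<le> N (restr (I k) Y)"
        using B_norm[of k] a0[of k] by (simp add: mult_left_mono)
    qed
    finally have "d - \<eta> \<le> (\<Sum>r\<in>{1..card F}. N (restr (I (h r)) Y))"
      using asum by (simp flip: sum_distrib_right)
    then have "l * \<theta> (Suc n) * (d - \<eta>) \<le> l * \<theta> (Suc n) * (\<Sum>r\<in>{1..card F}. N (restr (I (h r)) Y))"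
      using l \<theta>[of "Suc n"] by (intro mult_left_mono) auto
    also have "\<dots> \<le> N Y" by (rule lower[OF Yc _ adm]) simp
    finally show ?thesis using upper by linarith
  qed
  have "l * \<theta> (Suc n) * d \<le> 2 * M * (v ^ n / (1 - v)) + e" if e: "e > 0" for e
  proof -
    \<comment> \<open>The total coefficient of \<open>\<eta>\<close> in \<open>approx\<close> after
      expansion, so that \<open>\<eta> = e / c\<close> costs exactly \<open>e\<close>.\<close>
    define c where "c = l * \<theta> (Suc n) + 2 * M + 2"
    have c: "c > 0" using l \<theta>[of "Suc n"] M0 by (simp add: c_def add_pos_nonneg)
    have "l * \<theta> (Suc n) * d \<le> 2 * M * (v ^ n / (1 - v)) + c * (e / c)"
      using approx[of "e / c"] c e unfolding c_def by (simp only: algebra_simps) auto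
    then show ?thesis using c by simp
  qed
  then show ?thesis by (rule field_le_epsilon)
qed

text \<open>Supplies the data of \<open>theta_decay\<close>: continuity of the map at 0 bounds the
  images of the unit vectors from below, continuity of its inverse at 0 gives \<open>M\<close>, and
  boundedness on l_2 gives coordinatewise convergence to 0.\<close>

lemma not_isomorphic:
  assumes NY: "\<And>y. y \<in> c00 \<Longrightarrow> NY y = sqrt (P.weighted (\<lambda>n. (y n)\<^sup>2))"
    and lim: "(\<lambda>n. \<theta> n powr (1 / real n)) \<longlonglongrightarrow> 1"
  shows "\<not> isomorphic (convexification2 (completion N)) (completion NY)"
proof
  interpret Y: lattice_norm NY
    by (rule lattice_norm_cong[OF P.convexification_norm NY])
  define X2 where "X2 = convexification2 (completion N)"
  assume "isomorphic (convexification2 (completion N)) (completion NY)"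
  then obtain T where lin: "linear_on_space X2 T" and bij: "bij_betw T (fst X2) Y.CN"
    and T: "continuous_between X2 (completion NY) T"
    and S': "continuous_between (completion NY) X2 (inv_into (fst X2) T)"
    unfolding isomorphic_def X2_def by blast
  define S where "S = inv_into (fst X2) T"
  have X2: "z \<in> fst X2 \<longleftrightarrow> (\<lambda>n. (z n)\<^sup>2) \<in> X.CN" "snd X2 z = sqrt (X.NN (\<lambda>n. (z n)\<^sup>2))" for z
    by (simp_all add: X2_def convexification2_def)
  have zero: "(\<lambda>n. 0) \<in> fst X2" by (simp add: X2 X.c00_CN c00_zero)
  \<comment> \<open>The squared combination is dominated by a combination of squares, and the
    completion is an ideal. This closure lets the linearity of \<open>T\<close> pass to its inverse
    \<open>S\<close>.\<close>
  have X2_lin: "(\<lambda>n. a * z n + b * z' n) \<in> fst X2" if "z \<in> fst X2" "z' \<in> fst X2" for a b z z'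
  proof -
    have "(\<lambda>n. 2 * a\<^sup>2 * (z n)\<^sup>2 + 2 * b\<^sup>2 * (z' n)\<^sup>2) \<in> X.CN"
      using that unfolding X2 by (intro X.CN_add X.CN_scale)
    moreover have "\<bar>(a * z n + b * z' n)\<^sup>2\<bar> \<le> \<bar>2 * a\<^sup>2 * (z n)\<^sup>2 + 2 * b\<^sup>2 * (z' n)\<^sup>2\<bar>" for n
    proof -
      have "(a * z n + b * z' n)\<^sup>2 \<le> 2 * a\<^sup>2 * (z n)\<^sup>2 + 2 * b\<^sup>2 * (z' n)\<^sup>2"
        using zero_le_power2[of "a * z n - b * z' n"] by (simp add: power2_eq_square algebra_simps)
      then show ?thesis by simp
    qed
    ultimately show ?thesis unfolding X2 by (rule X.CN_dominated)
  qed
  have T_lin: "T (\<lambda>n. a * z n + b * z' n) = (\<lambda>n. a * T z n + b * T z' n)"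
    if "z \<in> fst X2" "z' \<in> fst X2" for a b z z'
    using lin that unfolding linear_on_space_def by blast
  have T0: "T (\<lambda>n. 0) = (\<lambda>n. 0)" using T_lin[OF zero zero, of 0 0] by simp
  have S_in: "S y \<in> fst X2" if "y \<in> Y.CN" for y
    using bij_betw_inv_into[OF bij] that by (auto simp: S_def bij_betw_def)
  have TS: "T (S y) = y" if "y \<in> Y.CN" for y
    unfolding S_def by (rule bij_betw_inv_into_right[OF bij that])
  have ST: "S (T z) = z" if "z \<in> fst X2" for z
    unfolding S_def by (rule bij_betw_inv_into_left[OF bij that])
  have S_lin: "S (\<lambda>n. a * y n + b * y' n) = (\<lambda>n. a * S y n + b * S y' n)"
    if "y \<in> Y.CN" "y' \<in> Y.CN" for a b y y'
    using ST[OF X2_lin[OF S_in[OF that(1)] S_in[OF that(2)], of a b]]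
      T_lin[OF S_in[OF that(1)] S_in[OF that(2)], of a b] TS that by simp
  have S0: "S (\<lambda>n. 0) = (\<lambda>n. 0)" using ST[OF zero] T0 by simp
  define x where "x i = S (unit_vec i)" for i
  have unit: "unit_vec i \<in> Y.CN" if "i \<ge> 1" for i by (rule Y.c00_CN[OF c00_unit_vec[OF that]])
  have x2: "(\<lambda>n. (x i n)\<^sup>2) \<in> X.CN" if "i \<ge> 1" for i
    using S_in[OF unit[OF that]] by (simp add: x_def X2)
  have S_comb: "S (comb i b F) = (\<lambda>n. \<Sum>k\<in>F. b k * x (i k) n)"
    if "finite F" "\<And>k. i k \<ge> 1" for F b and i :: "nat \<Rightarrow> nat"
    using that(1)
  proof (induction F rule: finite_induct)
    case empty
    then show ?case by (simp add: comb_def S0)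
  next
    case (insert k F)
    have "comb i b (insert k F) = (\<lambda>n. b k * unit_vec (i k) n + 1 * comb i b F n)"
      using insert by (simp add: comb_def)
    then have "S (comb i b (insert k F)) = (\<lambda>n. b k * x (i k) n + 1 * S (comb i b F) n)"
      using S_lin[OF unit[OF that(2)[of k]] Y.c00_CN[OF comb_c00[OF insert(1) that(2), where a = b]],
        of "b k" 1]
      by (simp add: x_def)
    then show ?case using insert by simp
  qed

  obtain \<delta> where \<delta>: "\<delta> > 0"
    "\<And>z. z \<in> fst X2 \<Longrightarrow> sqrt (X.NN (\<lambda>n. (z n)\<^sup>2)) < \<delta> \<Longrightarrow> Y.NN (T z) < 1"
    using T[unfolded continuous_between_def, rule_format, OF zero zero_less_one]
    by (auto simp: T0 X2(2))
  have d: "\<delta>\<^sup>2 \<le> X.NN (\<lambda>n. (x i n)\<^sup>2)" if i: "i \<ge> 1" for i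
  proof (rule ccontr)
    assume "\<not> ?thesis"
    then have "sqrt (X.NN (\<lambda>n. (x i n)\<^sup>2)) < \<delta>"
      using \<delta>(1) X.NN_nonneg[OF x2[OF i]] by (intro real_less_lsqrt) auto
    then have "Y.NN (T (x i)) < 1" using \<delta>(2)[of "x i"] S_in[OF unit[OF i]] by (simp add: x_def)
    then have "Y.NN (unit_vec i) < 1" using TS[OF unit[OF i]] by (simp add: x_def)
    then show False using Y.NN_coord[OF unit[OF i] i] by (simp add: unit_vec_def)
  qed

  obtain \<gamma> where \<gamma>: "\<gamma> > 0"
    "\<And>y. y \<in> Y.CN \<Longrightarrow> Y.NN y < \<gamma> \<Longrightarrow> sqrt (X.NN (\<lambda>n. (S y n)\<^sup>2)) < 1"
    using S'[folded S_def, unfolded continuous_between_def, rule_format,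
      OF Y.c00_CN[OF c00_zero] zero_less_one]
    by (auto simp: S0 X2(2))
  \<comment> \<open>Vectors are scaled to norm about \<open>\<gamma> / 2\<close>, inside the ball
    that \<open>S\<close> maps into the unit ball; the square matches the squared norms.\<close>
  define M where "M = (2 / \<gamma>)\<^sup>2"
  have M_pos: "M > 0" using \<gamma> by (simp add: M_def)
  have bounded: "X.NN (\<lambda>n. (S y n)\<^sup>2) \<le> M * P.weighted (\<lambda>n. (y n)\<^sup>2)" if y: "y \<in> c00" for y
  proof -
    have yC: "y \<in> Y.CN" by (rule Y.c00_CN[OF y])
    have Sy: "(\<lambda>n. (S y n)\<^sup>2) \<in> X.CN" using S_in[OF yC] by (simp add: X2)
    have "sqrt (X.NN (\<lambda>n. (S y n)\<^sup>2)) \<le> 2 / \<gamma> * NY y + e" if e: "e > 0" for e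
    proof -
      \<comment> \<open>Positive even for \<open>y = 0\<close>; the surplus becomes exactly
        \<open>e\<close> after multiplication by \<open>2 / \<gamma>\<close>.\<close>
      define c where "c = NY y + e * \<gamma> / 2"
      have c: "c > 0" "NY y \<le> c" using Y.nonneg[OF y] e \<gamma> by (auto simp: c_def add_nonneg_pos)
      define t where "t = \<gamma> / (2 * c)"
      have t: "t > 0" using c \<gamma> by (simp add: t_def)
      have "Y.NN (\<lambda>n. t * y n) = t * NY y"
        using t by (simp add: Y.NN_scale[OF yC] Y.NN_c00[OF y])
      also have "\<dots> \<le> t * c" using t c by simp
      also have "\<dots> < \<gamma>" using c \<gamma> by (simp add: t_def)
      finally have "sqrt (X.NN (\<lambda>n. (S (\<lambda>n. t * y n) n)\<^sup>2)) < 1"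
        by (intro \<gamma>(2) Y.CN_scale yC)
      moreover have "S (\<lambda>n. t * y n) = (\<lambda>n. t * S y n)"
        using S_lin[OF yC yC, of t 0] by simp
      ultimately have "sqrt (X.NN (\<lambda>n. t\<^sup>2 * (S y n)\<^sup>2)) < 1" by (simp add: power_mult_distrib)
      then have "t * sqrt (X.NN (\<lambda>n. (S y n)\<^sup>2)) < 1"
        using t by (simp add: X.NN_scale[OF Sy] real_sqrt_mult)
      then have "sqrt (X.NN (\<lambda>n. (S y n)\<^sup>2)) < 1 / t" using t by (simp add: field_simps)
      also have "1 / t = 2 / \<gamma> * NY y + e" using c \<gamma> by (simp add: t_def c_def field_simps)
      finally show ?thesis by simp
    qed
    then have "sqrt (X.NN (\<lambda>n. (S y n)\<^sup>2)) \<le> 2 / \<gamma> * NY y" by (rule field_le_epsilon)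
    then have "(sqrt (X.NN (\<lambda>n. (S y n)\<^sup>2)))\<^sup>2 \<le> (2 / \<gamma> * NY y)\<^sup>2"
      using X.NN_nonneg[OF Sy] by (intro power_mono) auto
    then show ?thesis
      using X.NN_nonneg[OF Sy] P.nonneg[OF c00_power2[OF y]]
      by (simp add: M_def NY[OF y] power_mult_distrib power_divide)
  qed
  have M: "(\<lambda>n. (\<Sum>k\<in>F. b k * x (i k) n)\<^sup>2) \<in> X.CN \<and>
      X.NN (\<lambda>n. (\<Sum>k\<in>F. b k * x (i k) n)\<^sup>2) \<le> M * P.weighted (comb i (\<lambda>k. (b k)\<^sup>2) F)"
    if "finite F" "inj i" "\<And>k. i k \<ge> 1" for F b and i :: "nat \<Rightarrow> nat"
  proof -
    have c: "comb i b F \<in> c00" by (rule comb_c00[OF that(1,3)])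
    have "S (comb i b F) = (\<lambda>n. \<Sum>k\<in>F. b k * x (i k) n)" by (rule S_comb[OF that(1,3)])
    then show ?thesis
      using S_in[OF Y.c00_CN[OF c]] bounded[OF c] unfolding X2 comb_power2[OF that(1,2)] by simp
  qed

  text \<open>The \<open>j\<close>-th coordinate functional is bounded on \<open>E_space \<beta>\<close>, hence on \<open>\<ell>\<^sub>2\<close>.\<close>
  have null: "(\<lambda>i. x i j) \<longlonglongrightarrow> 0" for j
  proof -
    have partial: "(\<Sum>k<m. (x (Suc k) j)\<^sup>2) \<le> M" for m
    proof (cases "j = 0")
      case True
      then show ?thesis using X.CN_0[OF x2] M_pos by simp
    next
      case False
      \<comment> \<open>Duality: evaluating the functional on its own coefficients gives
        \<open>A\<^sup>2 <= M * A\<close>, hence \<open>A <= M\<close> for every partial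
        sum.\<close>
      define b where "b k = x (Suc k) j" for k
      define A where "A = (\<Sum>k<m. (b k)\<^sup>2)"
      have A0: "0 \<le> A" by (simp add: A_def sum_nonneg)
      have C: "(\<lambda>n. (\<Sum>k<m. b k * x (Suc k) n)\<^sup>2) \<in> X.CN"
        and le: "X.NN (\<lambda>n. (\<Sum>k<m. b k * x (Suc k) n)\<^sup>2) \<le> M * P.weighted (comb Suc (\<lambda>k. (b k)\<^sup>2) {..<m})"
        using M[of "{..<m}" Suc b] by auto
      have "A\<^sup>2 = (\<Sum>k<m. b k * x (Suc k) j)\<^sup>2"
        by (simp add: A_def b_def power2_eq_square)
      also have "\<dots> \<le> X.NN (\<lambda>n. (\<Sum>k<m. b k * x (Suc k) n)\<^sup>2)"
        using X.NN_coord[OF C, of j] False by simp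
      also have "\<dots> \<le> M * P.weighted (comb Suc (\<lambda>k. (b k)\<^sup>2) {..<m})" by (rule le)
      also have "\<dots> \<le> M * l1 (comb Suc (\<lambda>k. (b k)\<^sup>2) {..<m})"
        using M_pos by (intro mult_left_mono P.weighted_le_l1 comb_c00) auto
      also have "\<dots> = M * A" by (simp add: l1_comb A_def)
      finally have "A * A \<le> M * A" by (simp add: power2_eq_square)
      then have "A \<le> M" using A0 M_pos by (cases "A = 0") auto
      then show ?thesis by (simp add: A_def b_def)
    qed
    have "summable (\<lambda>k. (x (Suc k) j)\<^sup>2)"
      by (rule summableI_nonneg_bounded[OF _ partial]) simp
    then have "(\<lambda>k. sqrt ((x (Suc k) j)\<^sup>2)) \<longlonglongrightarrow> sqrt 0"
      by (intro tendsto_real_sqrt summable_LIMSEQ_zero)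
    then have "(\<lambda>k. x (Suc k) j) \<longlonglongrightarrow> 0" by (simp add: tendsto_rabs_zero_iff)
    then show ?thesis by (rule LIMSEQ_imp_Suc)
  qed

  have decay: "l * \<theta> (Suc n) * \<delta>\<^sup>2 \<le> 2 * M * (v ^ n / (1 - v))" for n
    by (rule theta_decay[OF x2 null d M]) (use M_pos in auto)
  \<comment> \<open>The extra \<open>v\<close> in the denominator turns the exponent n - 1 of
    \<open>decay\<close> into n.\<close>
  define K where "K = 2 * M / (l * \<delta>\<^sup>2 * (1 - v) * v)"
  have "\<theta> n \<le> K * v ^ n" if n: "n \<ge> 1" for n
  proof -
    obtain n' where n': "n = Suc n'" using n by (cases n) auto
    have "\<theta> n * (l * \<delta>\<^sup>2) \<le> 2 * M * (v ^ n' / (1 - v))" using decay[of n'] n' by (simp add: mult_ac)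
    then have "\<theta> n \<le> 2 * M * (v ^ n' / (1 - v)) / (l * \<delta>\<^sup>2)"
      using l \<delta>(1) by (subst pos_le_divide_eq) auto
    also have "\<dots> = K * v ^ n" using v l \<delta>(1) by (simp add: K_def n' field_simps)
    finally show ?thesis .
  qed
  moreover have "K > 0" using l \<delta>(1) v M_pos by (simp add: K_def)
  ultimately show False using no_geometric_decay[OF _ v \<theta> _ lim] by blast
qed

end

section \<open>Application to V' and W'\<close>

theorem theorem3p8:
  fixes \<theta> \<alpha> \<beta> :: "nat \<Rightarrow> real" and s :: nat and l u :: real
  assumes "\<forall>n\<ge>1. 0 < \<theta> n \<and> \<theta> n < 1"
    and "\<theta> \<longlonglongrightarrow> 0"
    and "(\<lambda>n. \<theta> n powr (1 / real n)) \<longlonglongrightarrow> 1"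
    and "s \<ge> 1"
    and "\<forall>n\<ge>1. 0 < \<alpha> n \<and> \<alpha> n < 1"
    and "(\<lambda>n. \<alpha> (Suc n)) sums 1"
    and "0 < l" "l < 1" "0 < u" "u < 1"
    and "\<forall>n\<ge>1. l \<le> \<alpha> (Suc n) / \<alpha> n \<and> \<alpha> (Suc n) / \<alpha> n \<le> u"
    and "\<forall>n\<ge>1. 0 < \<beta> n \<and> \<beta> n < 1"
    and "(\<lambda>n. \<beta> (Suc n)) sums 1"
    and "0 < (INF n\<in>{1..}. \<beta> (Suc n) / \<beta> n)"
    and "bdd_above ((\<lambda>n. \<beta> (Suc n) / \<beta> n) ` {1..})"
    and "(SUP n\<in>{1..}. \<beta> (Suc n) / \<beta> n) < 1"
  shows "\<not> isomorphic (convexification2 (V'_space \<theta> \<alpha>)) (E_space \<beta>) \<and>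
         \<not> isomorphic (convexification2 (W'_space \<theta> s \<alpha>)) (E_space \<beta>)"
proof -
  define v where "v = (SUP n\<in>{1..}. \<beta> (Suc n) / \<beta> n)"
  have ratio: "\<beta> (Suc n) / \<beta> n \<le> v" if "n \<ge> 1" for n
    unfolding v_def by (rule cSUP_upper) (use that assms(15) in auto)
  have \<beta>v: "\<beta> (Suc n) \<le> v * \<beta> n" if "n \<ge> 1" for n
    using ratio[OF that] assms(12) that by (simp add: pos_divide_le_eq)
  have "0 < \<beta> (Suc 1) / \<beta> 1" using assms(12) by simp
  then have v: "0 < v" "v < 1" using ratio[of 1] assms(16) by (auto simp: v_def)
  interpret P: weighted_norm phi "\<lambda>n. {(k, E). admissible 1 k E}" "\<lambda>n. 1" \<beta>
    by unfold_locales (use assms(12,13) in auto)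
  have E\<beta>: "E\<beta>_norm \<beta> y = sqrt (P.weighted (\<lambda>n. (y n)\<^sup>2))" if "y \<in> c00" for y
    unfolding E\<beta>_norm_def P.weighted_def by (simp only: E_norm_power2[OF that])
  have main: "\<not> isomorphic (convexification2 (completion N)) (E_space \<beta>)"
    if "lattice_norm N" and "\<And>x n k E. x \<in> c00 \<Longrightarrow> n \<ge> 1 \<Longrightarrow> admissible n k E \<Longrightarrow>
      l * \<theta> n * (\<Sum>i\<in>{1..k}. N (restr (E i) x)) \<le> N x" for N
  proof -
    interpret X: lattice_norm N by (rule that(1))
    interpret comparison N \<beta> \<theta> l v
      by unfold_locales (use that(2) assms(1,7,12) \<beta>v v in \<open>auto simp: less_imp_le\<close>)
    show ?thesis unfolding E_space_def by (rule not_isomorphic[OF E\<beta> assms(3)])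
  qed
  interpret V: iterated_norm "V_norm \<theta>" "\<lambda>n. {(k, E). allowable n k E}" \<theta>
    by (rule V_iterated[OF assms(1)])
  interpret V: weighted_norm "V_norm \<theta>" "\<lambda>n. {(k, E). allowable n k E}" \<theta> \<alpha>
    by unfold_locales (use assms(5,6) in auto)
  interpret W: iterated_norm "W_norm \<theta> s"
    "\<lambda>n. if n \<le> s then {(k, E). allowable n k E} else {(k, E). admissible n k E}" \<theta>
    by (rule W_iterated[OF assms(1,4)])
  interpret W: weighted_norm "W_norm \<theta> s"
    "\<lambda>n. if n \<le> s then {(k, E). allowable n k E} else {(k, E). admissible n k E}" \<theta> \<alpha>
    by unfold_locales (use assms(5,6) in auto)
  have "\<not> isomorphic (convexification2 (completion V.weighted)) (E_space \<beta>)"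
    by (rule main[OF V.lattice_norm_axioms V.lower_estimate])
      (use assms(7,11) admissible_allowable in auto)
  moreover have "V'_norm \<theta> \<alpha> = V.weighted"
    by (simp add: fun_eq_iff V'_norm_def V.weighted_def)
  \<comment> \<open>For \<open>n <= s\<close> the estimate is for allowable families, which include
    the admissible ones; beyond \<open>s\<close> it is for admissible families directly.\<close>
  moreover have "\<not> isomorphic (convexification2 (completion W.weighted)) (E_space \<beta>)"
    by (rule main[OF W.lattice_norm_axioms W.lower_estimate])
      (use assms(7,11) admissible_allowable in auto)
  moreover have "W'_norm \<theta> s \<alpha> = W.weighted"
    by (simp add: fun_eq_iff W'_norm_def W.weighted_def)
  ultimately show ?thesis by (simp add: V'_space_def W'_space_def)
qed

end
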